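(* Let $W$ be the weakening monad on $[\mathcal H^{\mathrm{op}},\mathbf{Set}]$, i.e. the monad induced by the free-forgetful adjunction $\{w\}\text{-}\mathbf{GAT}\leftrightarrows[\mathcal H^{\mathrm{op}},\mathbf{Set}]$. The value at $X\in[\mathcal H^{\mathrm{op}},\mathbf{Set}]$ of its underlying endofunctor has (under the identification given in the context) type-elements and boundaries given by $$WX(n)=\sum_{\phi\in\mathrm{Hp}(n)}[\mathcal H^{\mathrm{op}},\mathbf{Set}]([\phi],X),\qquad \partial\colon WX(n+1)\to WX(n),\ (\phi,h)\mapsto(\partial\phi,\partial h),$$ and term-elements $\mathrm{Tm}_{WX}(\phi,h)=\mathrm{Tm}_X(h(n))$ for each $(\phi,h)\in WX(n)$.
   Context: \textbf{Expressions and judgements.} Fix a denumerable set $\mathrm{Var}$ of variables. Given an alphabet $\Xi$, the expressions over $\Xi$ are generated as follows: each $x\in\mathrm{Var}$ is an expression; if $n\geq 0$, $e_1,\dots,e_n$ are expressions and $w\in\Xi$, then $w(e_1,\dots,e_n)$ is an expression (written $w$ when $n=0$). $\mathsf{fv}$ denotes free variables and $e'[e/x]$ substitution of $e$ for $x$ in $e'$. A context is a (possibly empty) list $x_1:T_1,\dots,x_n:T_n$ of distinct variables $x_i$ and expressions $T_i$; $\mathsf{fv}(\Gamma)$ is the set of variables occurring in $\Gamma$. A judgement is a string $\Gamma\vdash T\ \mathsf{type}$ (type judgement), $\Gamma\vdash t:T$ (term judgement), $\Gamma\vdash T=T'\ \mathsf{type}$ (type equality) or $\Gamma\vdash t=t':T$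 (term equality), with $\Gamma$ a context and $t,t',T,T'$ expressions; its degree is one more than the length of $\Gamma$. The boundary of a judgement is a list of judgements: $\partial(\vdash T\ \mathsf{type})=()$; $\partial(\Gamma,x:T\vdash T'\ \mathsf{type})=(\Gamma\vdash T\ \mathsf{type})$; $\partial(\Gamma\vdash t:T)=(\Gamma\vdash T\ \mathsf{type})$; $\partial(\Gamma\vdash T=T'\ \mathsf{type})=(\Gamma\vdash T\ \mathsf{type},\ \Gamma\vdash T'\ \mathsf{type})$; $\partial(\Gamma\vdash t=t':T)=(\Gamma\vdash t:T,\ \Gamma\vdash t':T)$. \textbf{Deduction rules} (premises $\Longrightarrow$ conclusion; $\mathcal J$ stands for the right-hand side of any of the four judgement forms). \emph{Equality and $\alpha$ rules}: $\Gamma\vdash t:T\Longrightarrow\Gamma\vdash t=t:T$; $\Gamma\vdash t_1=t_2:T\Longrightarrow\Gamma\vdash t_2=t_1:T$; $\Gamma\vdash t_1=t_2:T$ and $\Gamma\vdash t_2=t_3:T\Longrightarrow\Gamma\vdash t_1=t_3:T$; $\Gamma\vdash T\ \mathsf{type}\Longrightarrow\Gamma\vdash T=T\ \mathsf{type}$; $\Gamma\vdash T_1=T_2\ \mathsf{type}\Longrightarrow\Gamma\vdash T_2=T_1\ \mathsf{type}$; $\Gamma\vdash T_1=T_2\ \mathsf{type}$ and $\Gamma\vdash T_2=T_3\ \mathsf{type}\Longrightarrow\Gamma\vdash T_1=T_3\ \mathsf{type}$; $\Gamma\vdash T_1=T_2\ \mathsf{type}$ and $\Gamma\vdash t:T_1\Longrightarrow\Gamma\vdash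 t:T_2$; $\Gamma\vdash T_1=T_2\ \mathsf{type}$ and $\Gamma\vdash t_1=t_2:T_1\Longrightarrow\Gamma\vdash t_1=t_2:T_2$; $\Gamma\vdash\mathcal J\Longrightarrow\sigma\cdot\Gamma\vdash\sigma\cdot\mathcal J$ for any permutation $\sigma\in\mathrm{Sym}(\mathrm{Var})$ acting on variables. \emph{Weakening} ($w$): $\Gamma\vdash T\ \mathsf{type}$ and $\Gamma,\Delta\vdash\mathcal J\Longrightarrow\Gamma,y:T,\Delta\vdash\mathcal J$, for $y\notin\mathsf{fv}(\Gamma)\cup\mathsf{fv}(\Delta)$. \textbf{$\{w\}$-GATs.} A $\{w\}$-GAT $\mathbb T$ consists of a collection $\Omega$ of type-constants, a collection $\Sigma$ of term-constants and a collection $\Lambda$ of basic judgements over $\Omega\amalg\Sigma$ such that: for each $A\in\Omega$ there is a unique judgement in $\Lambda$ of the form $x_1:T_1,\dots,x_{n-1}:T_{n-1}\vdash A(x_1,\dots,x_{n-1})\ \mathsf{type}$; for each $f\in\Sigma$ there is a unique judgement in $\Lambda$ of the form $x_1:T_1,\dots,x_{n-1}:T_{n-1}\vdash f(x_1,\dots,x_{n-1}):T$; all other elements of $\Lambda$ are type or term equality judgements; each element of $\Lambda$ lies in $\mathbb T^*$. Here $\mathbb T^*$, the collection of derived judgements, is the smallest collection closed under all the rules listed above and containing $\mathcal J\in\Lambda$ whenever it contains each judgement in $\partial(\mathcal J)$. An interpretation $\phi\colon\mathbb T\to\mathbb U$ is a function $\phi\colon\mathbb T^*\to\mathbb U^*$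 preserving boundaries and preserving deduction: viewing each rule with $n$ premises (for each choice of parameters such as $y$ or $\sigma$) as an $n$-ary partial function $r$ on judgements, $\phi(r(\mathcal J_1,\dots,\mathcal J_n))=r(\phi(\mathcal J_1),\dots,\phi(\mathcal J_n))$ whenever both sides are defined. On derived type judgements, $(x_1:S_1,\dots,x_{n-1}:S_{n-1}\vdash S_n\ \mathsf{type})\equiv(y_1:T_1,\dots,y_{m-1}:T_{m-1}\vdash T_m\ \mathsf{type})$ iff $n=m$ and for $1\le i\le n$ the judgement $x_1:S_1,\dots,x_{i-1}:S_{i-1}\vdash S_i=T_i[x_1/y_1,\dots,x_{i-1}/y_{i-1}]\ \mathsf{type}$ is derived. On derived term judgements, $(x_1:S_1,\dots,x_{n-1}:S_{n-1}\vdash s:S_n)\equiv(y_1:T_1,\dots,y_{m-1}:T_{m-1}\vdash t:T_m)$ iff their boundaries are $\equiv$ and $x_1:S_1,\dots,x_{n-1}:S_{n-1}\vdash s=t[x_1/y_1,\dots,x_{n-1}/y_{n-1}]:S_n$ is derived. $\{w\}\text{-}\mathbf{GAT}$ has $\{w\}$-GATs as objects and, as morphisms, interpretations modulo: $\phi\sim\phi'$ iff $\phi(\mathcal J)\equiv\phi'(\mathcal J)$ for each derived type or term judgement $\mathcal J$. \textbf{Type-and-term structures and the monad.} $[a,b]=\{a,\dots,b\}\subset\mathbb N$ and $[n]=[1,n]$. $\mathcal H$ is the category freely generated by the graph with objects $n$ and $n_t$ ($n\ge1$) and arrows $n\to n+1$ and $n\to n_t$. For $X\in[\mathcal H^{\mathrm{op}},\mathbf{Set}]$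 the maps $X(n+1)\to X(n)$, $X(n_t)\to X(n)$ are written $\partial$; elements of $X(n)$ are type-elements, elements of $X(n_t)$ term-elements; for $A\in X(n)$, $\mathrm{Tm}_X(A)=\{a\in X(n_t):\partial a=A\}$. A presheaf is specified by its type-elements, their boundaries and the sets $\mathrm{Tm}_X(A)$. The forgetful functor $V\colon\{w\}\text{-}\mathbf{GAT}\to[\mathcal H^{\mathrm{op}},\mathbf{Set}]$ has $V\mathbb T(n)$ (resp. $V\mathbb T(n_t)$) the set of derived type (resp. term) judgements of degree $n$ modulo $\equiv$, boundaries induced by $\partial$, and $V\phi([\mathcal J])=[\phi(\mathcal J)]$. Its left adjoint $G$ sends $X$ to the free $\{w\}$-GAT $GX$ whose type- and term-constants are the type- and term-elements of $X$ and whose basic judgements are $x_1:A_1,x_2:A_2(x_1),\dots,x_{n-1}:A_{n-1}(x_1,\dots,x_{n-2})\vdash A(x_1,\dots,x_{n-1})\ \mathsf{type}$ for $A\in X(n)$, where $A_i=\partial^{n-i}A$, and, in the same context, $\dots\vdash a(x_1,\dots,x_{n-1}):A(x_1,\dots,x_{n-1})$ for $a\in\mathrm{Tm}_X(A)$. Thus $W=VG$. \textbf{Heaps.} A min-heap of size $n$ is a function $\phi\colon[0,n]\to[0,n]$ with $\phi(0)=0$ and $\phi(i)<i$ for $i\in[n]$; $\mathrm{Hp}(n)$ is the set of these. For $\phi\in\mathrm{Hp}(n+1)$, $\partial\phi\in\mathrm{Hp}(n)$ is its restriction to $[0,n]$. For $i\in[n]$, $\mathsf{dp}_\phi(i)=|\{\phi(i),\phi^2(i),\dots\}|$.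 The presheaf $[\phi]$ has $[\phi](m)=\{i\in[n]:\mathsf{dp}_\phi(i)=m\}$, $[\phi](m_t)=\emptyset$, and boundaries $\partial(i)=\phi(i)$. For $h\colon[\phi]\to X$, with $\phi$ of size $>1$, $\partial h$ is the restriction of $h$ along the inclusion $[\partial\phi]\to[\phi]$. \textbf{Identification.} The pair $(\phi,h)$ with $\phi\in\mathrm{Hp}(n)$, $h\colon[\phi]\to X$ corresponds to the class in $VGX(n)$ of the judgement $x_1:T_1,\dots,x_{n-1}:T_{n-1}\vdash T_n\ \mathsf{type}$ of $GX$ in which $T_i=h(i)(x_{j_1},\dots,x_{j_{k-1}})$, with $k=\mathsf{dp}_\phi(i)$ and $j_\ell=\phi^{k-\ell}(i)$; and $a\in\mathrm{Tm}_X(h(n))$ corresponds to the class of $x_1:T_1,\dots,x_{n-1}:T_{n-1}\vdash a(x_{j_1},\dots,x_{j_{k-1}}):T_n$, with $j_1,\dots,j_{k-1}$ the indices for $i=n$. *)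

theory Defs
  imports "HOL-Library.FuncSet"
begin

section \<open>Expressions and judgements\<close>

type_synonym var = nat

datatype (syms: 'c) expr = Var var | App 'c "'c expr list"

primrec fv :: "'c expr \<Rightarrow> var set" where
  "fv (Var x) = {x}"
| "fv (App w es) = \<Union> (set (map fv es))"

text \<open>Simultaneous substitution. There are no binders, so no capture can occur.\<close>

primrec subst :: "(var \<Rightarrow> 'c expr) \<Rightarrow> 'c expr \<Rightarrow> 'c expr" where
  "subst s (Var x) = s x"
| "subst s (App w es) = App w (map (subst s) es)"

type_synonym 'c ctx = "(var \<times> 'c expr) list"

datatype (rhs_syms: 'c) rhs =
    IsTy "'c expr"
  | HasTy "'c expr" "'c expr"
  | EqTy "'c expr" "'c expr"
  | EqTm "'c expr" "'c expr" "'c expr"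

text \<open>
  \<open>(\<Gamma>, IsTy T)\<close> is \<open>\<Gamma> \<turnstile> T type\<close>, \<open>(\<Gamma>, HasTy t T)\<close> is \<open>\<Gamma> \<turnstile> t : T\<close>,
  \<open>(\<Gamma>, EqTy T T')\<close> is \<open>\<Gamma> \<turnstile> T = T' type\<close> and \<open>(\<Gamma>, EqTm t t' T)\<close> is \<open>\<Gamma> \<turnstile> t = t' : T\<close>.
\<close>

type_synonym 'c judg = "'c ctx \<times> 'c rhs"

definition fv_ctx :: "'c ctx \<Rightarrow> var set" where
  "fv_ctx \<Gamma> = (\<Union>(x, T)\<in>set \<Gamma>. insert x (fv T))"

definition judg_over :: "'c set \<Rightarrow> 'c judg \<Rightarrow> bool" where
  "judg_over \<Xi> J \<longleftrightarrow>
     distinct (map fst (fst J)) \<and> (\<forall>(x, T)\<in>set (fst J). syms T \<subseteq> \<Xi>) \<and> rhs_syms (snd J) \<subseteq> \<Xi>"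

definition degree :: "'c judg \<Rightarrow> nat" where
  "degree J = Suc (length (fst J))"

fun is_ty_judg :: "'c judg \<Rightarrow> bool" where
  "is_ty_judg (\<Gamma>, IsTy T) = True"
| "is_ty_judg _ = False"

fun is_tm_judg :: "'c judg \<Rightarrow> bool" where
  "is_tm_judg (\<Gamma>, HasTy t T) = True"
| "is_tm_judg _ = False"

fun boundary :: "'c judg \<Rightarrow> 'c judg list" where
  "boundary (\<Gamma>, IsTy T) = (if \<Gamma> = [] then [] else [(butlast \<Gamma>, IsTy (snd (last \<Gamma>)))])"
| "boundary (\<Gamma>, HasTy t T) = [(\<Gamma>, IsTy T)]"
| "boundary (\<Gamma>, EqTy T T') = [(\<Gamma>, IsTy T), (\<Gamma>, IsTy T')]"
| "boundary (\<Gamma>, EqTm t t' T) = [(\<Gamma>, HasTy t T), (\<Gamma>, HasTy t' T)]"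

definition ren :: "(var \<Rightarrow> var) \<Rightarrow> 'c expr \<Rightarrow> 'c expr" where
  "ren \<sigma> = subst (\<lambda>x. Var (\<sigma> x))"

definition ren_ctx :: "(var \<Rightarrow> var) \<Rightarrow> 'c ctx \<Rightarrow> 'c ctx" where
  "ren_ctx \<sigma> \<Gamma> = map (\<lambda>(x, T). (\<sigma> x, ren \<sigma> T)) \<Gamma>"

primrec ren_rhs :: "(var \<Rightarrow> var) \<Rightarrow> 'c rhs \<Rightarrow> 'c rhs" where
  "ren_rhs \<sigma> (IsTy T) = IsTy (ren \<sigma> T)"
| "ren_rhs \<sigma> (HasTy t T) = HasTy (ren \<sigma> t) (ren \<sigma> T)"
| "ren_rhs \<sigma> (EqTy T T') = EqTy (ren \<sigma> T) (ren \<sigma> T')"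
| "ren_rhs \<sigma> (EqTm t t' T) = EqTm (ren \<sigma> t) (ren \<sigma> t') (ren \<sigma> T)"

section \<open>Derived judgements and weakening GATs\<close>

inductive derived :: "'c judg set \<Rightarrow> 'c judg \<Rightarrow> bool" for \<Lambda> where
  basic: "J \<in> \<Lambda> \<Longrightarrow> \<forall>K\<in>set (boundary J). derived \<Lambda> K \<Longrightarrow> derived \<Lambda> J"
| tm_refl: "derived \<Lambda> (\<Gamma>, HasTy t T) \<Longrightarrow> derived \<Lambda> (\<Gamma>, EqTm t t T)"
| tm_sym: "derived \<Lambda> (\<Gamma>, EqTm t1 t2 T) \<Longrightarrow> derived \<Lambda> (\<Gamma>, EqTm t2 t1 T)"
| tm_trans: "derived \<Lambda> (\<Gamma>, EqTm t1 t2 T) \<Longrightarrow> derived \<Lambda> (\<Gamma>, EqTm t2 t3 T)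
    \<Longrightarrow> derived \<Lambda> (\<Gamma>, EqTm t1 t3 T)"
| ty_refl: "derived \<Lambda> (\<Gamma>, IsTy T) \<Longrightarrow> derived \<Lambda> (\<Gamma>, EqTy T T)"
| ty_sym: "derived \<Lambda> (\<Gamma>, EqTy T1 T2) \<Longrightarrow> derived \<Lambda> (\<Gamma>, EqTy T2 T1)"
| ty_trans: "derived \<Lambda> (\<Gamma>, EqTy T1 T2) \<Longrightarrow> derived \<Lambda> (\<Gamma>, EqTy T2 T3)
    \<Longrightarrow> derived \<Lambda> (\<Gamma>, EqTy T1 T3)"
| tm_conv: "derived \<Lambda> (\<Gamma>, EqTy T1 T2) \<Longrightarrow> derived \<Lambda> (\<Gamma>, HasTy t T1)
    \<Longrightarrow> derived \<Lambda> (\<Gamma>, HasTy t T2)"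
| eq_conv: "derived \<Lambda> (\<Gamma>, EqTy T1 T2) \<Longrightarrow> derived \<Lambda> (\<Gamma>, EqTm t1 t2 T1)
    \<Longrightarrow> derived \<Lambda> (\<Gamma>, EqTm t1 t2 T2)"
| alpha: "derived \<Lambda> (\<Gamma>, R) \<Longrightarrow> bij \<sigma> \<Longrightarrow> derived \<Lambda> (ren_ctx \<sigma> \<Gamma>, ren_rhs \<sigma> R)"
| weak: "derived \<Lambda> (\<Gamma>, IsTy T) \<Longrightarrow> derived \<Lambda> (\<Gamma> @ \<Delta>, R) \<Longrightarrow> y \<notin> fv_ctx \<Gamma> \<union> fv_ctx \<Delta>
    \<Longrightarrow> derived \<Lambda> (\<Gamma> @ (y, T) # \<Delta>, R)"

record ('o, 's) gat =
  ty_consts :: "'o set"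
  tm_consts :: "'s set"
  axioms :: "('o + 's) judg set"

definition introduces_ty :: "'o \<Rightarrow> ('o + 's) judg \<Rightarrow> bool" where
  "introduces_ty A J \<longleftrightarrow> (\<exists>\<Gamma>. J = (\<Gamma>, IsTy (App (Inl A) (map (\<lambda>(x, _). Var x) \<Gamma>))))"

definition introduces_tm :: "'s \<Rightarrow> ('o + 's) judg \<Rightarrow> bool" where
  "introduces_tm f J \<longleftrightarrow> (\<exists>\<Gamma> T. J = (\<Gamma>, HasTy (App (Inr f) (map (\<lambda>(x, _). Var x) \<Gamma>)) T))"

definition w_gat :: "('o, 's) gat \<Rightarrow> bool" where
  "w_gat \<T> \<longleftrightarrow>
     (\<forall>J\<in>axioms \<T>. judg_over (ty_consts \<T> <+> tm_consts \<T>) J) \<and>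
     (\<forall>A\<in>ty_consts \<T>. \<exists>!J. J \<in> axioms \<T> \<and> introduces_ty A J) \<and>
     (\<forall>f\<in>tm_consts \<T>. \<exists>!J. J \<in> axioms \<T> \<and> introduces_tm f J) \<and>
     (\<forall>J\<in>axioms \<T>. is_ty_judg J \<longrightarrow> (\<exists>A\<in>ty_consts \<T>. introduces_ty A J)) \<and>
     (\<forall>J\<in>axioms \<T>. is_tm_judg J \<longrightarrow> (\<exists>f\<in>tm_consts \<T>. introduces_tm f J)) \<and>
     (\<forall>J\<in>axioms \<T>. derived (axioms \<T>) J)"

text \<open>
  \<open>rename_to ys xs e\<close> is \<open>e[x\<^sub>1/y\<^sub>1, \<dots>, x\<^sub>n/y\<^sub>n]\<close>: the variables \<open>ys\<close> are replaced by \<open>xs\<close>.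
\<close>

definition rename_to :: "var list \<Rightarrow> var list \<Rightarrow> 'c expr \<Rightarrow> 'c expr" where
  "rename_to ys xs =
     subst (\<lambda>y. case map_of (zip ys xs) y of None \<Rightarrow> Var y | Some x \<Rightarrow> Var x)"

text \<open>The list of types \<open>T\<^sub>1, \<dots>, T\<^sub>n\<close> of \<open>y\<^sub>1 : T\<^sub>1, \<dots>, y\<^sub>n\<^sub>-\<^sub>1 : T\<^sub>n\<^sub>-\<^sub>1 \<turnstile> T\<^sub>n type\<close> is indexed from 0.\<close>

definition ty_equiv :: "('o, 's) gat \<Rightarrow> (('o + 's) judg \<times> ('o + 's) judg) set" where
  "ty_equiv \<T> = {((\<Gamma>, IsTy S), (\<Delta>, IsTy T)) | \<Gamma> S \<Delta> T.
     derived (axioms \<T>) (\<Gamma>, IsTy S) \<and> derived (axioms \<T>) (\<Delta>, IsTy T) \<and>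
     length \<Gamma> = length \<Delta> \<and>
     (\<forall>i\<le>length \<Gamma>. derived (axioms \<T>)
        (take i \<Gamma>,
         EqTy ((map snd \<Gamma> @ [S]) ! i)
              (rename_to (map fst (take i \<Delta>)) (map fst (take i \<Gamma>)) ((map snd \<Delta> @ [T]) ! i))))}"

definition tm_equiv :: "('o, 's) gat \<Rightarrow> (('o + 's) judg \<times> ('o + 's) judg) set" where
  "tm_equiv \<T> = {((\<Gamma>, HasTy s S), (\<Delta>, HasTy t T)) | \<Gamma> s S \<Delta> t T.
     derived (axioms \<T>) (\<Gamma>, HasTy s S) \<and> derived (axioms \<T>) (\<Delta>, HasTy t T) \<and>
     ((\<Gamma>, IsTy S), (\<Delta>, IsTy T)) \<in> ty_equiv \<T> \<and>
     derived (axioms \<T>) (\<Gamma>, EqTm s (rename_to (map fst \<Delta>) (map fst \<Gamma>) t) S)}"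

section \<open>Type-and-term structures\<close>

text \<open>
  As \<open>\<H>\<close> is freely generated by its graph, a presheaf on \<open>\<H>\<close> amounts to sets \<open>X(n)\<close> and
  \<open>X(n\<^sub>t)\<close> for \<open>n \<ge> 1\<close> together with arbitrary functions \<open>bd X n : X(n + 1) \<rightarrow> X(n)\<close> and
  \<open>tm_bd X n : X(n\<^sub>t) \<rightarrow> X(n)\<close>, and naturality need only be checked on these. The sets for
  different \<open>n\<close> may overlap, and the index 0 is never used.
\<close>

record ('a, 'b) tts =
  ty_el :: "nat \<Rightarrow> 'a set"
  tm_el :: "nat \<Rightarrow> 'b set"
  bd :: "nat \<Rightarrow> 'a \<Rightarrow> 'a"
  tm_bd :: "nat \<Rightarrow> 'b \<Rightarrow> 'a"

definition presheaf :: "('a, 'b) tts \<Rightarrow> bool" where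
  "presheaf X \<longleftrightarrow>
     (\<forall>n\<ge>1. bd X n \<in> ty_el X (Suc n) \<rightarrow> ty_el X n \<and> tm_bd X n \<in> tm_el X n \<rightarrow> ty_el X n)"

text \<open>\<open>Tm X n A\<close> is the set of terms of type \<open>A \<in> X(n)\<close>.\<close>

definition Tm :: "('a, 'b) tts \<Rightarrow> nat \<Rightarrow> 'a \<Rightarrow> 'b set" where
  "Tm X n A = {a \<in> tm_el X n. tm_bd X n a = A}"

type_synonym ('a, 'b, 'c, 'd) tts_map = "(nat \<Rightarrow> 'a \<Rightarrow> 'c) \<times> (nat \<Rightarrow> 'b \<Rightarrow> 'd)"

definition psh_hom :: "('a, 'b) tts \<Rightarrow> ('c, 'd) tts \<Rightarrow> ('a, 'b, 'c, 'd) tts_map set" where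
  "psh_hom X Y = {(f, g).
     f \<in> (\<Pi>\<^sub>E n\<in>{1..}. ty_el X n \<rightarrow>\<^sub>E ty_el Y n) \<and>
     g \<in> (\<Pi>\<^sub>E n\<in>{1..}. tm_el X n \<rightarrow>\<^sub>E tm_el Y n) \<and>
     (\<forall>n\<ge>1. \<forall>A\<in>ty_el X (Suc n). f n (bd X n A) = bd Y n (f (Suc n) A)) \<and>
     (\<forall>n\<ge>1. \<forall>a\<in>tm_el X n. f n (tm_bd X n a) = tm_bd Y n (g n a))}"

text \<open>Composition with the inclusion of a subpresheaf \<open>Y\<close> of the domain.\<close>

definition hom_restrict ::
    "('a, 'b, 'c, 'd) tts_map \<Rightarrow> ('a, 'b) tts \<Rightarrow> ('a, 'b, 'c, 'd) tts_map" where
  "hom_restrict h Y =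
     ((\<lambda>n\<in>{1..}. restrict (fst h n) (ty_el Y n)), (\<lambda>n\<in>{1..}. restrict (snd h n) (tm_el Y n)))"

section \<open>The weakening monad\<close>

text \<open>
  The boundary of a class is the class of the boundary of any representative; it is obtained
  as the union of these (equal) classes.
\<close>

definition V :: "('o, 's) gat \<Rightarrow> (('o + 's) judg set, ('o + 's) judg set) tts" where
  "V \<T> = \<lparr>
     ty_el = (\<lambda>n. {J. derived (axioms \<T>) J \<and> is_ty_judg J \<and> degree J = n} // ty_equiv \<T>),
     tm_el = (\<lambda>n. {J. derived (axioms \<T>) J \<and> is_tm_judg J \<and> degree J = n} // tm_equiv \<T>),
     bd = (\<lambda>n C. \<Union>J\<in>C. ty_equiv \<T> `` set (boundary J)),
     tm_bd = (\<lambda>n C. \<Union>J\<in>C. ty_equiv \<T> `` set (boundary J))\<rparr>"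

text \<open>\<open>iter_bd X n k A\<close> is \<open>\<partial>\<^sup>k A\<close> for \<open>A \<in> X(n)\<close>.\<close>

primrec iter_bd :: "('a, 'b) tts \<Rightarrow> nat \<Rightarrow> nat \<Rightarrow> 'a \<Rightarrow> 'a" where
  "iter_bd X n 0 A = A"
| "iter_bd X n (Suc k) A = bd X (n - Suc k) (iter_bd X n k A)"

text \<open>
  The constants of \<open>GX\<close> are the pairs \<open>(n, A)\<close> with \<open>A \<in> X(n)\<close> and \<open>(n, a)\<close> with
  \<open>a \<in> X(n\<^sub>t)\<close>, and the variable \<open>x\<^sub>i\<close> is the number \<open>i\<close>.
\<close>

definition free_ctx :: "('a, 'b) tts \<Rightarrow> nat \<Rightarrow> 'a \<Rightarrow> (nat \<times> 'a + nat \<times> 'b) ctx" where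
  "free_ctx X n A = map (\<lambda>i. (i, App (Inl (i, iter_bd X n (n - i) A)) (map Var [1..<i]))) [1..<n]"

definition free_ty :: "('a, 'b) tts \<Rightarrow> nat \<Rightarrow> 'a \<Rightarrow> (nat \<times> 'a + nat \<times> 'b) judg" where
  "free_ty X n A = (free_ctx X n A, IsTy (App (Inl (n, A)) (map Var [1..<n])))"

definition free_tm :: "('a, 'b) tts \<Rightarrow> nat \<Rightarrow> 'b \<Rightarrow> (nat \<times> 'a + nat \<times> 'b) judg" where
  "free_tm X n a =
     (free_ctx X n (tm_bd X n a),
      HasTy (App (Inr (n, a)) (map Var [1..<n])) (App (Inl (n, tm_bd X n a)) (map Var [1..<n])))"

definition G :: "('a, 'b) tts \<Rightarrow> (nat \<times> 'a, nat \<times> 'b) gat" where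
  "G X = \<lparr>
     ty_consts = (SIGMA n:{1..}. ty_el X n),
     tm_consts = (SIGMA n:{1..}. tm_el X n),
     axioms = {free_ty X n A | n A. 1 \<le> n \<and> A \<in> ty_el X n} \<union>
              {free_tm X n a | n a. 1 \<le> n \<and> a \<in> tm_el X n}\<rparr>"

lemma iter_bd_in:
  assumes "presheaf X" "A \<in> ty_el X n" "k < n"
  shows "iter_bd X n k A \<in> ty_el X (n - k)"
  using assms(3)
proof (induction k)
  case 0
  then show ?case using assms by simp
next
  case (Suc k)
  then have "iter_bd X n k A \<in> ty_el X (Suc (n - Suc k))"
    by (simp add: Suc_diff_Suc)
  with Suc.prems assms(1) show ?case
    unfolding presheaf_def by (auto simp: Pi_iff)
qed

lemma iter_bd_bd: "iter_bd X n k (bd X n A) = iter_bd X (Suc n) (Suc k) A"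
  by (induction k) simp_all

lemma free_ctx_Suc:
  assumes "1 \<le> n"
  shows "free_ctx X (Suc n) A =
    free_ctx X n (bd X n A) @ [(n, App (Inl (n, bd X n A)) (map Var [1..<n]))]"
proof -
  have "iter_bd X (Suc n) (Suc n - i) A = iter_bd X n (n - i) (bd X n A)" if "i < n" for i
    using that by (simp add: iter_bd_bd Suc_diff_le del: iter_bd.simps(2))
  then show ?thesis
    using assms by (simp add: free_ctx_def)
qed

lemma free_ctx_vars: "map (\<lambda>(x, _). Var x) (free_ctx X n A) = map Var [1..<n]"
  by (simp add: free_ctx_def comp_def)

lemma derived_free_ty:
  assumes "presheaf X" "A \<in> ty_el X (Suc n)"
  shows "derived (axioms (G X)) (free_ty X (Suc n) A)"
  using assms(2)
proof (induction n arbitrary: A)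
  case 0
  show ?case
  proof (rule derived.basic)
    show "free_ty X (Suc 0) A \<in> axioms (G X)"
      using 0 by (auto simp: G_def)
  qed (simp add: free_ty_def free_ctx_def)
next
  case (Suc n)
  have bd_in: "bd X (Suc n) A \<in> ty_el X (Suc n)"
    using Suc.prems assms(1) by (auto simp: presheaf_def Pi_iff)
  show ?case
  proof (rule derived.basic)
    show "free_ty X (Suc (Suc n)) A \<in> axioms (G X)"
      using Suc.prems unfolding G_def by force
    have "boundary (free_ty X (Suc (Suc n)) A) = [free_ty X (Suc n) (bd X (Suc n) A)]"
      by (simp add: free_ty_def free_ctx_Suc)
    then show "\<forall>K\<in>set (boundary (free_ty X (Suc (Suc n)) A)). derived (axioms (G X)) K"
      using Suc.IH[OF bd_in] by simp
  qed
qed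

lemma judg_over_free_ctx:
  assumes "presheaf X" "A \<in> ty_el X n"
  shows "distinct (map fst (free_ctx X n A))"
    and "\<forall>(x, T)\<in>set (free_ctx X n A). syms T \<subseteq> ty_consts (G X) <+> tm_consts (G X)"
proof -
  show "distinct (map fst (free_ctx X n A))"
    by (simp add: free_ctx_def comp_def)
  have "iter_bd X n (n - i) A \<in> ty_el X i" if "1 \<le> i" "i < n" for i
    using iter_bd_in[OF assms, of "n - i"] that by simp
  then show "\<forall>(x, T)\<in>set (free_ctx X n A). syms T \<subseteq> ty_consts (G X) <+> tm_consts (G X)"
    by (auto simp: free_ctx_def G_def)
qed

lemma introduces_free_ty: "introduces_ty p (free_ty X n A) \<longleftrightarrow> p = (n, A)"
  by (auto simp: introduces_ty_def free_ty_def free_ctx_vars simp del: One_nat_def)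

lemma introduces_free_tm: "introduces_tm p (free_tm X n a) \<longleftrightarrow> p = (n, a)"
  by (auto simp: introduces_tm_def free_tm_def free_ctx_vars simp del: One_nat_def)

theorem w_gat_G:
  assumes X: "presheaf X"
  shows "w_gat (G X)"
proof -
  have tm_bd_in: "tm_bd X n a \<in> ty_el X n" if "1 \<le> n" "a \<in> tm_el X n" for n a
    using X that by (auto simp: presheaf_def Pi_iff)
  have ax: "J \<in> axioms (G X) \<longleftrightarrow>
      (\<exists>n A. 1 \<le> n \<and> A \<in> ty_el X n \<and> J = free_ty X n A) \<or>
      (\<exists>n a. 1 \<le> n \<and> a \<in> tm_el X n \<and> J = free_tm X n a)" for J
    by (auto simp: G_def)
  have not_tm: "\<not> introduces_ty p (free_tm X n a)" "\<not> is_ty_judg (free_tm X n a)" for p n a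
    by (auto simp: introduces_ty_def free_tm_def)
  have not_ty: "\<not> introduces_tm p (free_ty X n A)" "\<not> is_tm_judg (free_ty X n A)" for p n A
    by (auto simp: introduces_tm_def free_ty_def)
  have der_ty: "derived (axioms (G X)) (free_ty X n A)" if "1 \<le> n" "A \<in> ty_el X n" for n A
    using derived_free_ty[OF X, of A "n - 1"] that by simp
  have der_tm: "derived (axioms (G X)) (free_tm X n a)" if "1 \<le> n" "a \<in> tm_el X n" for n a
  proof (rule derived.basic)
    show "free_tm X n a \<in> axioms (G X)"
      using that ax by blast
    have "boundary (free_tm X n a) = [free_ty X n (tm_bd X n a)]"
      by (simp add: free_ty_def free_tm_def)
    then show "\<forall>K\<in>set (boundary (free_tm X n a)). derived (axioms (G X)) K"
      using der_ty[OF that(1) tm_bd_in[OF that]] by simp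
  qed
  have over_ty: "judg_over (ty_consts (G X) <+> tm_consts (G X)) (free_ty X n A)"
    if "1 \<le> n" "A \<in> ty_el X n" for n A
    using judg_over_free_ctx[OF X that(2)] that
    by (auto simp: judg_over_def free_ty_def G_def)
  have over_tm: "judg_over (ty_consts (G X) <+> tm_consts (G X)) (free_tm X n a)"
    if "1 \<le> n" "a \<in> tm_el X n" for n a
    using judg_over_free_ctx[OF X tm_bd_in[OF that]] that tm_bd_in[OF that]
    by (auto simp: judg_over_def free_tm_def G_def)
  have uniq_ty: "\<exists>!J. J \<in> axioms (G X) \<and> introduces_ty p J" if "p \<in> ty_consts (G X)" for p
  proof (rule ex1I[of _ "free_ty X (fst p) (snd p)"])
    show "free_ty X (fst p) (snd p) \<in> axioms (G X) \<and>
        introduces_ty p (free_ty X (fst p) (snd p))"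
      using that by (auto simp: ax introduces_free_ty G_def)
  qed (auto simp: ax introduces_free_ty not_tm)
  have uniq_tm: "\<exists>!J. J \<in> axioms (G X) \<and> introduces_tm p J" if "p \<in> tm_consts (G X)" for p
  proof (rule ex1I[of _ "free_tm X (fst p) (snd p)"])
    show "free_tm X (fst p) (snd p) \<in> axioms (G X) \<and>
        introduces_tm p (free_tm X (fst p) (snd p))"
      using that by (auto simp: ax introduces_free_tm G_def)
  qed (auto simp: ax introduces_free_tm not_ty)
  have intro_ty: "\<exists>p\<in>ty_consts (G X). introduces_ty p J"
    if J: "J \<in> axioms (G X)" "is_ty_judg J" for J
  proof -
    obtain n A where "1 \<le> n" "A \<in> ty_el X n" "J = free_ty X n A"
      using J by (auto simp: ax not_tm)
    then show ?thesis
      by (intro bexI[of _ "(n, A)"]) (auto simp: introduces_free_ty G_def)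
  qed
  have intro_tm: "\<exists>p\<in>tm_consts (G X). introduces_tm p J"
    if J: "J \<in> axioms (G X)" "is_tm_judg J" for J
  proof -
    obtain n a where "1 \<le> n" "a \<in> tm_el X n" "J = free_tm X n a"
      using J by (auto simp: ax not_ty)
    then show ?thesis
      by (intro bexI[of _ "(n, a)"]) (auto simp: introduces_free_tm G_def)
  qed
  show ?thesis
    unfolding w_gat_def
  proof (intro conjI ballI impI)
    fix J assume "J \<in> axioms (G X)"
    then consider n A where "1 \<le> n" "A \<in> ty_el X n" "J = free_ty X n A"
      | n a where "1 \<le> n" "a \<in> tm_el X n" "J = free_tm X n a"
      unfolding ax by blast
    then show "judg_over (ty_consts (G X) <+> tm_consts (G X)) J" "derived (axioms (G X)) J"
      by (cases; simp add: over_ty over_tm der_ty der_tm)+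
  qed (fact uniq_ty uniq_tm intro_ty intro_tm)+
qed

text \<open>The underlying endofunctor of the monad, on objects.\<close>

definition W :: "('a, 'b) tts \<Rightarrow>
    ((nat \<times> 'a + nat \<times> 'b) judg set, (nat \<times> 'a + nat \<times> 'b) judg set) tts" where
  "W X = V (G X)"

section \<open>Heaps\<close>

definition Hp :: "nat \<Rightarrow> (nat \<Rightarrow> nat) set" where
  "Hp n = {\<phi> \<in> {0..n} \<rightarrow>\<^sub>E {0..n}. \<phi> 0 = 0 \<and> (\<forall>i\<in>{1..n}. \<phi> i < i)}"

definition heap_bd :: "nat \<Rightarrow> (nat \<Rightarrow> nat) \<Rightarrow> nat \<Rightarrow> nat" where
  "heap_bd n \<phi> = restrict \<phi> {0..n}"

definition dp :: "(nat \<Rightarrow> nat) \<Rightarrow> nat \<Rightarrow> nat" where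
  "dp \<phi> i = card ((\<lambda>k. (\<phi> ^^ k) i) ` {1..})"

text \<open>
  \<open>heap_psh n \<phi>\<close> is the presheaf \<open>[\<phi>]\<close> for \<open>\<phi> \<in> Hp n\<close>. It has no term-elements, so their
  ambient type is irrelevant.
\<close>

definition heap_psh :: "nat \<Rightarrow> (nat \<Rightarrow> nat) \<Rightarrow> (nat, unit) tts" where
  "heap_psh n \<phi> = \<lparr>
     ty_el = (\<lambda>m. {i \<in> {1..n}. dp \<phi> i = m}),
     tm_el = (\<lambda>m. {}),
     bd = (\<lambda>m i. \<phi> i),
     tm_bd = undefined\<rparr>"

type_synonym ('a, 'b) heap_map = "(nat, unit, 'a, 'b) tts_map"

text \<open>\<open>h(i)\<close>, an element of \<open>X(dp \<phi> i)\<close>.\<close>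

definition heap_val :: "(nat \<Rightarrow> nat) \<Rightarrow> ('a, 'b) heap_map \<Rightarrow> nat \<Rightarrow> 'a" where
  "heap_val \<phi> h i = fst h (dp \<phi> i) i"

section \<open>The identification\<close>

definition path_vars :: "(nat \<Rightarrow> nat) \<Rightarrow> nat \<Rightarrow> 'c expr list" where
  "path_vars \<phi> i = map (\<lambda>l. Var ((\<phi> ^^ (dp \<phi> i - l)) i)) [1..<dp \<phi> i]"

definition heap_type ::
    "(nat \<Rightarrow> nat) \<Rightarrow> ('a, 'b) heap_map \<Rightarrow> nat \<Rightarrow> (nat \<times> 'a + nat \<times> 'b) expr" where
  "heap_type \<phi> h i = App (Inl (dp \<phi> i, heap_val \<phi> h i)) (path_vars \<phi> i)"

definition heap_ctx ::
    "nat \<Rightarrow> (nat \<Rightarrow> nat) \<Rightarrow> ('a, 'b) heap_map \<Rightarrow> (nat \<times> 'a + nat \<times> 'b) ctx" where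
  "heap_ctx n \<phi> h = map (\<lambda>i. (i, heap_type \<phi> h i)) [1..<n]"

fun ty_ident :: "('a, 'b) tts \<Rightarrow> nat \<Rightarrow> (nat \<Rightarrow> nat) \<times> ('a, 'b) heap_map
    \<Rightarrow> (nat \<times> 'a + nat \<times> 'b) judg set" where
  "ty_ident X n (\<phi>, h) = ty_equiv (G X) `` {(heap_ctx n \<phi> h, IsTy (heap_type \<phi> h n))}"

fun tm_ident :: "('a, 'b) tts \<Rightarrow> nat \<Rightarrow> (nat \<Rightarrow> nat) \<times> ('a, 'b) heap_map
    \<Rightarrow> 'b \<Rightarrow> (nat \<times> 'a + nat \<times> 'b) judg set" where
  "tm_ident X n (\<phi>, h) a = tm_equiv (G X) ``
     {(heap_ctx n \<phi> h, HasTy (App (Inr (dp \<phi> n, a)) (path_vars \<phi> n)) (heap_type \<phi> h n))}"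

end

theory Submission
  imports Defs "HOL-Combinatorics.Transposition"
begin

text \<open>
  A derivation from weakening alone never substitutes a term for a variable, and no rule makes
  a variable into a term. So the only types and terms that can occur in a derived judgement of
  \<open>GX\<close> are constants applied to variables, as in the basic judgements. A type in a derived
  context therefore has the form \<open>A(x\<^sub>1, \<dots>, x\<^sub>k)\<close> where the types declared for
  \<open>x\<^sub>1, \<dots>, x\<^sub>k\<close> are the iterated boundaries of \<open>A\<close>, each applied to the variables before its
  own: the arguments form a path. Equations have to start from reflexivity and can only be
  transported along equations, so they are syntactic identities. Conversely, every judgement
  of this shape is derivable: the variables off the path of its subject can be removed by
  inverting weakening, and what is left is a renaming of a basic judgement. This is
  \<open>derived_iff_path\<close>, the heart of the proof.

  As equations are identities, equivalence of judgements is the same as differing by a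
  permutation of the variables (\<open>ty_equiv_iff_alpha_eq\<close>, \<open>tm_equiv_iff_alpha_eq\<close>). Hence every
  class contains exactly one judgement whose context declares the variables
  \<open>1, \<dots>, n - 1\<close> in this order (\<open>ex_canonical\<close>, \<open>canonical_unique\<close>).

  Such a canonical judgement is determined by two data for each of its types \<open>T\<^sub>1, \<dots>, T\<^sub>n\<close>: the
  constant at its head and the last variable of its path, as the rest of the path can be read
  off from the type of that variable. Sending \<open>i\<close> to the last variable of \<open>T\<^sub>i\<close>, or to 0 if the
  path is empty, is a min-heap \<open>\<phi>\<close>, because a type mentions earlier variables only; the heads
  form a map \<open>[\<phi>] \<rightarrow> X\<close>, because the type of the last variable carries the boundary of the
  head (\<open>bij_betw_heap_judg\<close>). A term of the last type is a term constant over its head, with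
  the same arguments, which gives the description of the term-elements. Boundaries drop the
  last entry on both sides.
\<close>

section \<open>Renaming of variables\<close>

abbreviation ctx_vars :: "'c ctx \<Rightarrow> var set" where
  "ctx_vars \<Gamma> \<equiv> fst ` set \<Gamma>"

definition ren_judg :: "(var \<Rightarrow> var) \<Rightarrow> 'c judg \<Rightarrow> 'c judg" where
  "ren_judg \<sigma> J = (ren_ctx \<sigma> (fst J), ren_rhs \<sigma> (snd J))"

lemma ren_simps [simp]:
  "ren \<sigma> (Var x) = Var (\<sigma> x)"
  "ren \<sigma> (App w es) = App w (map (ren \<sigma>) es)"
  by (simp_all add: ren_def)

lemma map_ren_Var [simp]: "map (ren \<sigma>) (map Var xs) = map Var (map \<sigma> xs)"
  by simp

lemma map_Var_eq_iff: "map Var xs = map Var ys \<longleftrightarrow> xs = ys"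
  by (simp add: inj_map_eq_map inj_def)

lemma ren_ident: "(\<And>x. x \<in> fv e \<Longrightarrow> \<sigma> x = x) \<Longrightarrow> ren \<sigma> e = e"
  by (induction e) (auto intro: map_idI)

lemma ren_ren: "ren \<sigma> (ren \<tau> e) = ren (\<sigma> \<circ> \<tau>) e"
  by (induction e) auto

lemma ren_judg_ren_judg: "ren_judg \<sigma> (ren_judg \<tau> J) = ren_judg (\<sigma> \<circ> \<tau>) J"
  by (cases J; cases "snd J") (auto simp: ren_judg_def ren_ctx_def ren_ren)

lemma ren_judg_id: "ren_judg id J = J"
  by (cases J; cases "snd J") (auto simp: ren_judg_def ren_ctx_def ren_ident intro!: map_idI)

lemma map_fst_ren_ctx: "map fst (ren_ctx \<sigma> \<Gamma>) = map \<sigma> (map fst \<Gamma>)"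
  by (auto simp: ren_ctx_def)

lemma ctx_vars_ren_ctx: "ctx_vars (ren_ctx \<sigma> \<Gamma>) = \<sigma> ` ctx_vars \<Gamma>"
  by (force simp: ren_ctx_def)

lemma rename_to_eq_ren:
  assumes "fv e \<subseteq> set ys"
  shows "rename_to ys (map \<sigma> ys) e = ren \<sigma> e"
  using assms
proof (induction e)
  case (Var x)
  then show ?case by (simp add: rename_to_def map_of_zip_map)
next
  case (App w es)
  have "map (rename_to ys (map \<sigma> ys)) es = map (ren \<sigma>) es"
    using App by (intro map_cong) auto
  then show ?case
    by (simp add: rename_to_def)
qed

text \<open>
  Composing with one transposition per list entry extends a finite renaming to a permutation
  of all variables, as the rule for renamings asks for.
\<close>

lemma ex_bij_map_eq:
  fixes xs ys :: "'a list"
  assumes "distinct xs" "distinct ys" "length xs = length ys"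
  shows "\<exists>\<sigma>. bij \<sigma> \<and> map \<sigma> xs = ys"
  using assms
proof (induction xs arbitrary: ys)
  case Nil
  then show ?case by (auto intro: bij_id)
next
  case (Cons x xs)
  from Cons.prems obtain y ys' where ys: "ys = y # ys'"
    by (cases ys) auto
  with Cons obtain \<sigma> where \<sigma>: "bij \<sigma>" "map \<sigma> xs = ys'"
    by auto
  have "transpose (\<sigma> x) y (\<sigma> z) = \<sigma> z" if "z \<in> set xs" for z
  proof (rule transpose_apply_other)
    show "\<sigma> z \<noteq> \<sigma> x"
      using that Cons.prems(1) bij_is_inj[OF \<sigma>(1)] by (auto dest: injD)
    show "\<sigma> z \<noteq> y"
      using that Cons.prems(2) ys \<sigma>(2) by auto
  qed
  then have "map (transpose (\<sigma> x) y \<circ> \<sigma>) (x # xs) = ys"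
    using \<sigma>(2) ys by auto
  moreover have "bij (transpose (\<sigma> x) y \<circ> \<sigma>)"
    using \<sigma>(1) by (intro bij_comp) auto
  ultimately show ?case by blast
qed

section \<open>Derived judgements of a free theory\<close>

text \<open>
  A type is a constant applied to a path. The condition is local: it looks up the type of the
  last argument only, which must carry the boundary of the constant and have exactly the
  remaining arguments. The conditions on the earlier arguments then follow from the same
  condition on that type, once the context consists of such types.
\<close>

definition path_type ::
    "('a, 'b) tts \<Rightarrow> (nat \<times> 'a + nat \<times> 'b) ctx \<Rightarrow> (nat \<times> 'a + nat \<times> 'b) expr \<Rightarrow> bool" where
  "path_type X \<Gamma> T \<longleftrightarrow>
     (\<exists>A. A \<in> ty_el X 1 \<and> T = App (Inl (1, A)) []) \<or>
     (\<exists>n A y ys. 1 \<le> n \<and> A \<in> ty_el X (Suc n) \<and>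
        (y, App (Inl (n, bd X n A)) (map Var ys)) \<in> set \<Gamma> \<and>
        T = App (Inl (Suc n, A)) (map Var (ys @ [y])))"

lemma path_type_cases [consumes 1, case_names root step]:
  assumes "path_type X \<Gamma> T"
  obtains A where "A \<in> ty_el X 1" "T = App (Inl (1, A)) []"
  | n A y ys where "1 \<le> n" "A \<in> ty_el X (Suc n)"
      "(y, App (Inl (n, bd X n A)) (map Var ys)) \<in> set \<Gamma>"
      "T = App (Inl (Suc n, A)) (map Var (ys @ [y]))"
  using assms unfolding path_type_def by blast

inductive path_ctx :: "('a, 'b) tts \<Rightarrow> (nat \<times> 'a + nat \<times> 'b) ctx \<Rightarrow> bool" for X where
  empty: "path_ctx X []"
| extend: "path_ctx X \<Gamma> \<Longrightarrow> x \<notin> ctx_vars \<Gamma> \<Longrightarrow> path_type X \<Gamma> T \<Longrightarrow> path_ctx X (\<Gamma> @ [(x, T)])"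

text \<open>
  A term constant over the head of its type, with the same arguments. There is no clause for
  variables: no rule derives that a variable is a term.
\<close>

definition path_term ::
    "('a, 'b) tts \<Rightarrow> (nat \<times> 'a + nat \<times> 'b) expr \<Rightarrow> (nat \<times> 'a + nat \<times> 'b) expr \<Rightarrow> bool" where
  "path_term X t T \<longleftrightarrow> (\<exists>n a es. 1 \<le> n \<and> a \<in> tm_el X n \<and>
     t = App (Inr (n, a)) es \<and> T = App (Inl (n, tm_bd X n a)) es)"

primrec path_rhs ::
    "('a, 'b) tts \<Rightarrow> (nat \<times> 'a + nat \<times> 'b) ctx \<Rightarrow> (nat \<times> 'a + nat \<times> 'b) rhs \<Rightarrow> bool" where
  "path_rhs X \<Gamma> (IsTy T) \<longleftrightarrow> path_type X \<Gamma> T"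
| "path_rhs X \<Gamma> (HasTy t T) \<longleftrightarrow> path_type X \<Gamma> T \<and> path_term X t T"
| "path_rhs X \<Gamma> (EqTy T T') \<longleftrightarrow> path_type X \<Gamma> T \<and> T = T'"
| "path_rhs X \<Gamma> (EqTm t t' T) \<longleftrightarrow> path_type X \<Gamma> T \<and> path_term X t T \<and> t = t'"

lemma path_ctx_snoc:
  "path_ctx X (\<Gamma> @ [(x, T)]) \<longleftrightarrow> path_ctx X \<Gamma> \<and> x \<notin> ctx_vars \<Gamma> \<and> path_type X \<Gamma> T"
  by (subst path_ctx.simps) auto

lemma path_type_mono: "path_type X \<Gamma> T \<Longrightarrow> set \<Gamma> \<subseteq> set \<Delta> \<Longrightarrow> path_type X \<Delta> T"
  unfolding path_type_def by blast

lemma path_rhs_mono: "path_rhs X \<Gamma> R \<Longrightarrow> set \<Gamma> \<subseteq> set \<Delta> \<Longrightarrow> path_rhs X \<Delta> R"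
  by (cases R) (auto intro: path_type_mono)

lemma path_ctx_distinct: "path_ctx X \<Gamma> \<Longrightarrow> distinct (map fst \<Gamma>)"
  by (induction rule: path_ctx.induct) auto

lemma fv_path_type_subset:
  assumes "path_ctx X \<Gamma>" "path_type X \<Gamma> T"
  shows "fv T \<subseteq> ctx_vars \<Gamma>"
  using assms
proof (induction arbitrary: T rule: path_ctx.induct)
  case empty
  then show ?case by (auto simp: path_type_def)
next
  case (extend \<Gamma> x S)
  have old: "fv U \<subseteq> ctx_vars \<Gamma>" if "path_type X \<Gamma> U" for U
    using extend.IH[OF that] .
  from extend.prems show ?case
  proof (cases rule: path_type_cases)
    case (step n A y ys)
    show ?thesis
    proof (cases "(y, App (Inl (n, bd X n A)) (map Var ys)) \<in> set \<Gamma>")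
      case True
      then have "path_type X \<Gamma> T"
        using step unfolding path_type_def by blast
      then show ?thesis using old by force
    next
      case False
      then have "y = x" "S = App (Inl (n, bd X n A)) (map Var ys)"
        using step by auto
      then show ?thesis
        using old[OF extend.hyps(3)] step by auto
    qed
  qed simp
qed

lemma path_ctx_type: "path_ctx X \<Gamma> \<Longrightarrow> (x, T) \<in> set \<Gamma> \<Longrightarrow> path_type X \<Gamma> T"
  by (induction rule: path_ctx.induct) (auto elim!: path_type_mono)

lemma fv_ctx_path_ctx:
  assumes "path_ctx X \<Gamma>"
  shows "fv_ctx \<Gamma> = ctx_vars \<Gamma>"
proof
  show "fv_ctx \<Gamma> \<subseteq> ctx_vars \<Gamma>"
    using fv_path_type_subset[OF assms path_ctx_type[OF assms]]
    unfolding fv_ctx_def by (auto simp: rev_image_eqI)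
qed (force simp: fv_ctx_def)

lemma fv_path_rhs_subset:
  assumes "path_ctx X \<Gamma>" "path_rhs X \<Gamma> (HasTy t T)"
  shows "fv t \<subseteq> ctx_vars \<Gamma>"
  using fv_path_type_subset[OF assms(1), of T] assms(2) by (auto simp: path_term_def)

text \<open>
  The variables of a type are downward closed: with a variable, the type mentions all the
  variables on which that variable depends. This is what allows removing every variable that
  does not occur in a given type without orphaning one that does. It holds inductively, as the
  type of the last argument has exactly the other arguments as its variables.
\<close>

lemma path_type_closed:
  assumes "path_ctx X \<Gamma>" "path_type X \<Gamma> T" "z \<in> fv T" "(z, U) \<in> set \<Gamma>"
  shows "fv U \<subseteq> fv T"
  using assms
proof (induction arbitrary: T rule: path_ctx.induct)
  case empty
  then show ?case by simp
next
  case (extend \<Gamma> x S)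
  have old: "fv U \<subseteq> fv V" if "path_type X \<Gamma> V" "z \<in> fv V" for V
  proof -
    have "z \<in> ctx_vars \<Gamma>"
      using fv_path_type_subset[OF extend.hyps(1) that(1)] that(2) by blast
    then have "(z, U) \<in> set \<Gamma>"
      using extend.hyps(2) extend.prems(3) by auto
    then show ?thesis
      using extend.IH that by blast
  qed
  from extend.prems(1) show ?case
  proof (cases rule: path_type_cases)
    case root
    then show ?thesis using extend.prems(2) by simp
  next
    case (step n A y ys)
    show ?thesis
    proof (cases "(y, App (Inl (n, bd X n A)) (map Var ys)) \<in> set \<Gamma>")
      case True
      then have "path_type X \<Gamma> T"
        using step unfolding path_type_def by blast
      then show ?thesis using old extend.prems(2) by blast
    next
      case False
      then have y: "y = x" "S = App (Inl (n, bd X n A)) (map Var ys)"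
        using step by auto
      show ?thesis
      proof (cases "z = x")
        case True
        then have "U = S"
          using extend.prems(3) extend.hyps(2) by force
        then show ?thesis using y step by auto
      next
        case False
        then have "z \<in> fv S"
          using extend.prems(2) y step by auto
        then show ?thesis
          using old[OF extend.hyps(3)] y step by auto
      qed
    qed
  qed
qed

lemma path_ctx_prefix:
  assumes "path_ctx X \<Gamma>" "path_type X \<Gamma> S" "i \<le> length \<Gamma>"
  shows "path_ctx X (take i \<Gamma>) \<and> path_type X (take i \<Gamma>) ((map snd \<Gamma> @ [S]) ! i)"
  using assms
proof (induction arbitrary: S rule: path_ctx.induct)
  case empty
  then show ?case by (auto intro: path_ctx.empty)
next
  case (extend \<Gamma> x T)
  show ?case
  proof (cases "i = Suc (length \<Gamma>)")
    case True
    then show ?thesis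
      using extend by (auto simp: nth_append path_ctx_snoc)
  next
    case False
    then show ?thesis
      using extend.IH[OF extend.hyps(3)] extend.prems by (auto simp: nth_append)
  qed
qed

lemma path_type_insert: "path_type X (\<Gamma> @ \<Delta>) T \<Longrightarrow> path_type X (\<Gamma> @ p # \<Delta>) T"
  by (erule path_type_mono) auto

text \<open>
  Weakening in the middle of a context is harmless, since the form of the later types depends
  only on which declarations are present.
\<close>

lemma path_ctx_insert:
  assumes "path_ctx X (\<Gamma> @ \<Delta>)" "path_type X \<Gamma> T" "y \<notin> ctx_vars (\<Gamma> @ \<Delta>)"
  shows "path_ctx X (\<Gamma> @ (y, T) # \<Delta>)"
  using assms
proof (induction \<Delta> rule: rev_induct)
  case Nil
  then show ?case by (simp add: path_ctx_snoc)
next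
  case (snoc p \<Delta>)
  obtain z U where p: "p = (z, U)" by (cases p)
  have "path_ctx X ((\<Gamma> @ \<Delta>) @ [(z, U)])"
    using snoc.prems(1) p by simp
  then have *: "path_ctx X (\<Gamma> @ \<Delta>)" "z \<notin> ctx_vars (\<Gamma> @ \<Delta>)" "path_type X (\<Gamma> @ \<Delta>) U"
    unfolding path_ctx_snoc by auto
  have "path_ctx X ((\<Gamma> @ (y, T) # \<Delta>) @ [(z, U)])"
    unfolding path_ctx_snoc
    using snoc * p path_type_insert by auto
  then show ?case using p by simp
qed

lemma path_type_remove:
  "path_type X (\<Gamma> @ (x, S) # \<Delta>) T \<Longrightarrow> x \<notin> fv T \<Longrightarrow> path_type X (\<Gamma> @ \<Delta>) T"
  unfolding path_type_def by fastforce

text \<open>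
  Inversion of weakening. Checking the form of a type only looks up one of its own variables,
  so removing a variable that no later type mentions does not affect them.
\<close>

lemma path_ctx_remove:
  assumes "path_ctx X (\<Gamma> @ (x, S) # \<Delta>)" "\<And>z U. (z, U) \<in> set \<Delta> \<Longrightarrow> x \<notin> fv U"
  shows "path_ctx X \<Gamma> \<and> path_type X \<Gamma> S \<and> path_ctx X (\<Gamma> @ \<Delta>)"
  using assms
proof (induction \<Delta> rule: rev_induct)
  case Nil
  then show ?case by (simp add: path_ctx_snoc)
next
  case (snoc p \<Delta>)
  obtain z U where p: "p = (z, U)" by (cases p)
  have "path_ctx X ((\<Gamma> @ (x, S) # \<Delta>) @ [(z, U)])"
    using snoc.prems(1) p by simp
  then have *: "path_ctx X (\<Gamma> @ (x, S) # \<Delta>)" "z \<notin> ctx_vars (\<Gamma> @ \<Delta>)"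
      "path_type X (\<Gamma> @ (x, S) # \<Delta>) U"
    unfolding path_ctx_snoc by auto
  have "path_ctx X ((\<Gamma> @ \<Delta>) @ [(z, U)])"
    unfolding path_ctx_snoc
    using snoc * p path_type_remove[OF *(3)] by auto
  then show ?case using p snoc * by auto
qed

lemma path_type_ren:
  assumes "path_type X \<Gamma> T"
  shows "path_type X (ren_ctx \<sigma> \<Gamma>) (ren \<sigma> T)"
  using assms
proof (cases rule: path_type_cases)
  case (step n A y ys)
  have "(\<sigma> y, App (Inl (n, bd X n A)) (map Var (map \<sigma> ys))) \<in> set (ren_ctx \<sigma> \<Gamma>)"
    using step(3) by (force simp: ren_ctx_def)
  moreover have "ren \<sigma> T = App (Inl (Suc n, A)) (map Var (map \<sigma> ys @ [\<sigma> y]))"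
    using step(4) by simp
  ultimately show ?thesis
    using step(1,2) unfolding path_type_def by blast
qed (auto simp: path_type_def)

lemma path_rhs_ren: "path_rhs X \<Gamma> R \<Longrightarrow> path_rhs X (ren_ctx \<sigma> \<Gamma>) (ren_rhs \<sigma> R)"
  by (cases R) (auto simp: path_type_ren path_term_def)

lemma path_ctx_ren: "path_ctx X \<Gamma> \<Longrightarrow> inj \<sigma> \<Longrightarrow> path_ctx X (ren_ctx \<sigma> \<Gamma>)"
proof (induction rule: path_ctx.induct)
  case empty
  then show ?case by (simp add: ren_ctx_def path_ctx.empty)
next
  case (extend \<Gamma> x T)
  have "\<sigma> x \<notin> ctx_vars (ren_ctx \<sigma> \<Gamma>)"
    using extend unfolding ctx_vars_ren_ctx by (simp add: inj_image_mem_iff)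
  then have "path_ctx X (ren_ctx \<sigma> \<Gamma> @ [(\<sigma> x, ren \<sigma> T)])"
    using extend path_type_ren by (intro path_ctx.extend) auto
  then show ?case by (simp add: ren_ctx_def)
qed

lemma path_ctx_free_ctx:
  assumes X: "presheaf X" and "A \<in> ty_el X (Suc n)"
  shows "path_ctx X (free_ctx X (Suc n) A) \<and>
    path_type X (free_ctx X (Suc n) A) (App (Inl (Suc n, A)) (map Var [1..<Suc n]))"
  using assms(2)
proof (induction n arbitrary: A)
  case 0
  then show ?case
    by (auto simp: free_ctx_def path_type_def intro: path_ctx.empty)
next
  case (Suc n)
  let ?B = "bd X (Suc n) A"
  have B: "?B \<in> ty_el X (Suc n)"
    using X Suc.prems by (auto simp: presheaf_def Pi_iff)
  have ctx: "free_ctx X (Suc (Suc n)) A =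
      free_ctx X (Suc n) ?B @ [(Suc n, App (Inl (Suc n, ?B)) (map Var [1..<Suc n]))]"
    by (rule free_ctx_Suc) simp
  have "Suc n \<notin> ctx_vars (free_ctx X (Suc n) ?B)"
    by (auto simp: free_ctx_def)
  then have "path_ctx X (free_ctx X (Suc (Suc n)) A)"
    unfolding ctx path_ctx_snoc using Suc.IH[OF B] by simp
  moreover have "path_type X (free_ctx X (Suc (Suc n)) A)
      (App (Inl (Suc (Suc n), A)) (map Var ([1..<Suc n] @ [Suc n])))"
    unfolding path_type_def ctx using Suc.prems by force
  ultimately show ?case by simp
qed

text \<open>
  Induction on derivations. The rules for equality and conversion preserve the form because
  both sides of each equation are already identical.
\<close>

lemma derived_imp_path:
  assumes X: "presheaf X" and "derived (axioms (G X)) J"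
  shows "path_ctx X (fst J) \<and> path_rhs X (fst J) (snd J)"
  using assms(2)
proof (induction rule: derived.induct)
  case (basic J)
  have tm_bd_in: "tm_bd X n a \<in> ty_el X n" if "1 \<le> n" "a \<in> tm_el X n" for n a
    using X that by (auto simp: presheaf_def Pi_iff)
  from basic(1) consider n A where "1 \<le> n" "A \<in> ty_el X n" "J = free_ty X n A"
    | n a where "1 \<le> n" "a \<in> tm_el X n" "J = free_tm X n a"
    by (auto simp: G_def)
  then show ?case
  proof cases
    case (1 n A)
    then show ?thesis
      using path_ctx_free_ctx[OF X, of A "n - 1"] by (simp add: free_ty_def)
  next
    case (2 n a)
    moreover have "path_term X (App (Inr (n, a)) (map Var [1..<n]))
        (App (Inl (n, tm_bd X n a)) (map Var [1..<n]))"
      using 2 unfolding path_term_def by blast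
    ultimately show ?thesis
      using path_ctx_free_ctx[OF X, of "tm_bd X n a" "n - 1"] tm_bd_in[of n a]
      by (simp add: free_tm_def)
  qed
next
  case (alpha \<Gamma> R \<sigma>)
  then show ?case by (simp add: path_ctx_ren path_rhs_ren bij_is_inj)
next
  case (weak \<Gamma> T \<Delta> R y)
  have "y \<notin> ctx_vars (\<Gamma> @ \<Delta>)"
    using weak.hyps(3) by (force simp: fv_ctx_def)
  then have "path_ctx X (\<Gamma> @ (y, T) # \<Delta>)"
    using weak.IH by (intro path_ctx_insert) auto
  moreover have "path_rhs X (\<Gamma> @ (y, T) # \<Delta>) R"
    using weak.IH(2) by (auto elim: path_rhs_mono)
  ultimately show ?case by simp
qed auto

text \<open>
  This recognises the contexts of basic judgements, up to renaming, as those without a variable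
  off the path of the type. The induction peels off the last declaration, which has to be that
  of the last argument, so that the remaining context is again of this kind for the boundary.
\<close>

lemma path_ctx_eq_ren_free_ctx:
  assumes "path_ctx X \<Gamma>" "path_type X \<Gamma> (App (Inl (n, A)) (map Var ys))"
    "ctx_vars \<Gamma> \<subseteq> set ys"
  shows "map fst \<Gamma> = ys \<and> Suc (length ys) = n \<and>
    (\<forall>\<sigma>. map \<sigma> [1..<n] = ys \<longrightarrow> \<Gamma> = ren_ctx \<sigma> (free_ctx X n A))"
  using assms
proof (induction arbitrary: n A ys rule: path_ctx.induct)
  case empty
  then show ?case by (auto simp: path_type_def free_ctx_def ren_ctx_def)
next
  case (extend \<Gamma> x T)
  from extend.prems(1) show ?case
  proof (cases rule: path_type_cases)
    case root
    then show ?thesis using extend.prems(2) by simp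
  next
    case (step m B y zs)
    let ?S = "App (Inl (m, bd X m B)) (map Var zs) :: (nat \<times> 'a + nat \<times> 'b) expr"
    have eqs: "n = Suc m" "A = B" "ys = zs @ [y]"
      using step(4) by (simp_all only: expr.inject sum.inject prod.inject map_Var_eq_iff)
    have fv_T: "fv T \<subseteq> ctx_vars \<Gamma>"
      using fv_path_type_subset extend.hyps by blast
    have x_in: "x \<in> set ys" using extend.prems(2) by simp
    \<comment> \<open>Otherwise the whole path would lie in the context without its last variable,
      so that variable would be off the path.\<close>
    have "(y, ?S) \<notin> set \<Gamma>"
    proof
      assume y: "(y, ?S) \<in> set \<Gamma>"
      have "fv ?S \<subseteq> ctx_vars \<Gamma>"
        using fv_path_type_subset[OF extend.hyps(1) path_ctx_type[OF extend.hyps(1) y]] .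
      then have "set ys \<subseteq> ctx_vars \<Gamma>"
        using y eqs by force
      then show False using x_in extend.hyps(2) by blast
    qed
    then have y: "y = x" "T = ?S" using step(3) by auto
    have "ctx_vars \<Gamma> \<subseteq> set zs"
      using extend.prems(2) extend.hyps(2) eqs y by auto
    then have IH: "map fst \<Gamma> = zs \<and> Suc (length zs) = m \<and>
        (\<forall>\<sigma>. map \<sigma> [1..<m] = zs \<longrightarrow> \<Gamma> = ren_ctx \<sigma> (free_ctx X m (bd X m B)))"
      using extend.IH extend.hyps(3) y by blast
    have "\<Gamma> @ [(x, T)] = ren_ctx \<sigma> (free_ctx X n A)" if "map \<sigma> [1..<n] = ys" for \<sigma>
    proof -
      have *: "map \<sigma> [1..<m] = zs" "\<sigma> m = y"
        using that eqs step(1) by auto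
      then have "\<Gamma> = ren_ctx \<sigma> (free_ctx X m (bd X m B))"
        using IH by blast
      moreover have "map (ren \<sigma>) (map Var [1..<m] :: (nat \<times> 'a + nat \<times> 'b) expr list) = map Var zs"
        by (simp only: map_ren_Var *)
      ultimately show ?thesis
        using * y eqs free_ctx_Suc[OF step(1), of X B] by (simp add: ren_ctx_def)
    qed
    then show ?thesis using IH eqs y by simp
  qed
qed

text \<open>
  Removing the last variable off the path of the subject, which no later type mentions, leads
  by induction to a context that is just the path, where the judgement is a renaming of a
  basic one.
\<close>

lemma path_imp_derived:
  assumes "path_ctx X \<Gamma>" "path_rhs X \<Gamma> R" "R = IsTy T \<or> R = HasTy t T" and X: "presheaf X"
  shows "derived (axioms (G X)) (\<Gamma>, R)"
  using assms(1-3)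
proof (induction "length \<Gamma>" arbitrary: \<Gamma> R T t rule: less_induct)
  case less
  note \<Gamma> = less.prems(1)
  have T: "path_type X \<Gamma> T"
    using less.prems(2,3) by auto
  then obtain n A ys where T_eq: "T = App (Inl (n, A)) (map Var ys)"
    and n: "1 \<le> n" and A: "A \<in> ty_el X n"
  proof (cases rule: path_type_cases)
    case (root A)
    then show thesis using that[of 1 A "[]"] by simp
  next
    case (step n A y ys)
    then show thesis using that[of "Suc n" A "ys @ [y]"] by simp
  qed
  have fv_T: "fv T = set ys" using T_eq by auto
  show ?case
  proof (cases "ctx_vars \<Gamma> \<subseteq> set ys")
    case True
    note * = path_ctx_eq_ren_free_ctx[OF \<Gamma> T[unfolded T_eq] True]
    have "distinct ys"
      using * path_ctx_distinct[OF \<Gamma>] by simp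
    then obtain \<sigma> where \<sigma>: "bij \<sigma>" "map \<sigma> [1..<n] = ys"
      using ex_bij_map_eq[of "[1..<n]" ys] * by auto
    then have ctx: "\<Gamma> = ren_ctx \<sigma> (free_ctx X n A)"
      using * by blast
    obtain J where J: "J \<in> {free_ty X n A} \<union> {free_tm X n a | a. a \<in> tm_el X n}"
      "(\<Gamma>, R) = ren_judg \<sigma> J"
    proof (cases "R = IsTy T")
      case True
      then have "(\<Gamma>, R) = ren_judg \<sigma> (free_ty X n A)"
        using T_eq ctx \<sigma>(2) by (simp add: ren_judg_def free_ty_def flip: map_map)
      then show thesis using that by blast
    next
      case False
      then have R: "R = HasTy t T" using less.prems(3) by blast
      then obtain a where "a \<in> tm_el X n" "tm_bd X n a = A" "t = App (Inr (n, a)) (map Var ys)"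
        using less.prems(2) T_eq by (auto simp: path_term_def)
      moreover from this have "(\<Gamma>, R) = ren_judg \<sigma> (free_tm X n a)"
        using T_eq R ctx \<sigma>(2) by (simp add: ren_judg_def free_tm_def flip: map_map)
      ultimately show thesis using that by blast
    qed
    have "J \<in> axioms (G X)"
      using J(1) n A by (auto simp: G_def)
    then have "derived (axioms (G X)) J"
      using w_gat_G[OF X] by (auto simp: w_gat_def)
    then show ?thesis
      using J(2) derived.alpha[of _ "fst J" "snd J" \<sigma>] \<sigma>(1) by (simp add: ren_judg_def)
  next
    case False
    \<comment> \<open>The last variable off the path: all later variables are on the path, so by closure
      their types only mention variables on the path.\<close>
    then have "\<exists>p\<in>set \<Gamma>. fst p \<notin> set ys" by auto
    then obtain \<Gamma>1 p \<Gamma>2 where split: "\<Gamma> = \<Gamma>1 @ p # \<Gamma>2" "fst p \<notin> set ys"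
        "\<forall>q\<in>set \<Gamma>2. \<not> fst q \<notin> set ys"
      by (rule split_list_last_propE)
    obtain x S where p: "p = (x, S)" by (cases p)
    have x: "x \<notin> fv T" using split p fv_T by simp
    have x_U: "x \<notin> fv U" if "(z, U) \<in> set \<Gamma>2" for z U
      using path_type_closed[OF \<Gamma> T, of z U] that split fv_T x by fastforce
    have *: "path_ctx X \<Gamma>1" "path_type X \<Gamma>1 S" "path_ctx X (\<Gamma>1 @ \<Gamma>2)"
      using path_ctx_remove[of X \<Gamma>1 x S \<Gamma>2] x_U \<Gamma> split p by auto
    have "path_type X (\<Gamma>1 @ \<Gamma>2) T"
      using path_type_remove[of X \<Gamma>1 x S \<Gamma>2 T] T x split p by simp
    then have R: "path_rhs X (\<Gamma>1 @ \<Gamma>2) R"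
      using less.prems(2,3) by auto
    have "x \<notin> ctx_vars (\<Gamma>1 @ \<Gamma>2)"
      using path_ctx_distinct[OF \<Gamma>] split p by auto
    then have fresh: "x \<notin> fv_ctx \<Gamma>1 \<union> fv_ctx \<Gamma>2"
      using fv_ctx_path_ctx[OF *(3)] by (auto simp: fv_ctx_def)
    have "derived (axioms (G X)) (\<Gamma>1, IsTy S)"
      by (rule less.hyps[of \<Gamma>1 "IsTy S" S]) (use * split in auto)
    moreover have "derived (axioms (G X)) (\<Gamma>1 @ \<Gamma>2, R)"
      by (rule less.hyps[of "\<Gamma>1 @ \<Gamma>2" R T t]) (use * R less.prems(3) split in auto)
    ultimately show ?thesis
      using derived.weak[OF _ _ fresh] split p by simp
  qed
qed

theorem derived_iff_path:
  assumes X: "presheaf X"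
  shows "derived (axioms (G X)) (\<Gamma>, R) \<longleftrightarrow> path_ctx X \<Gamma> \<and> path_rhs X \<Gamma> R"
proof
  assume "derived (axioms (G X)) (\<Gamma>, R)"
  then show "path_ctx X \<Gamma> \<and> path_rhs X \<Gamma> R"
    using derived_imp_path[OF X] by fastforce
next
  assume *: "path_ctx X \<Gamma> \<and> path_rhs X \<Gamma> R"
  show "derived (axioms (G X)) (\<Gamma>, R)"
  proof (cases R)
    case (EqTy T T')
    then show ?thesis
      using path_imp_derived[of X \<Gamma> "IsTy T"] * X by (auto intro: derived.ty_refl)
  next
    case (EqTm t t' T)
    then show ?thesis
      using path_imp_derived[of X \<Gamma> "HasTy t T"] * X by (auto intro: derived.tm_refl)
  qed (use path_imp_derived * X in blast)+
qed

section \<open>Equivalence of judgements is renaming\<close>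

definition alpha_eq :: "'c judg \<Rightarrow> 'c judg \<Rightarrow> bool" where
  "alpha_eq J K \<longleftrightarrow> (\<exists>\<sigma>. bij \<sigma> \<and> J = ren_judg \<sigma> K)"

lemma alpha_eq_refl: "alpha_eq J J"
  unfolding alpha_eq_def by (rule exI[of _ id]) (simp add: ren_judg_id)

lemma alpha_eq_sym:
  assumes "alpha_eq J K"
  shows "alpha_eq K J"
proof -
  from assms obtain \<sigma> where \<sigma>: "bij \<sigma>" "J = ren_judg \<sigma> K"
    by (auto simp: alpha_eq_def)
  then have "K = ren_judg (inv \<sigma>) J"
    by (simp add: ren_judg_ren_judg bij_is_inj ren_judg_id)
  then show ?thesis
    using bij_imp_bij_inv[OF \<sigma>(1)] unfolding alpha_eq_def by blast
qed

lemma alpha_eq_trans: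
  assumes "alpha_eq I J" "alpha_eq J K"
  shows "alpha_eq I K"
proof -
  from assms obtain \<sigma> \<tau> where "bij \<sigma>" "I = ren_judg \<sigma> J" "bij \<tau>" "J = ren_judg \<tau> K"
    by (auto simp: alpha_eq_def)
  then have "bij (\<sigma> \<circ> \<tau>)" "I = ren_judg (\<sigma> \<circ> \<tau>) K"
    by (simp_all add: bij_comp ren_judg_ren_judg)
  then show ?thesis
    unfolding alpha_eq_def by blast
qed

lemma is_ty_judg_iff: "is_ty_judg J \<longleftrightarrow> (\<exists>\<Gamma> T. J = (\<Gamma>, IsTy T))"
  by (cases J rule: is_ty_judg.cases) auto

lemma is_tm_judg_iff: "is_tm_judg J \<longleftrightarrow> (\<exists>\<Gamma> t T. J = (\<Gamma>, HasTy t T))"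
  by (cases J rule: is_tm_judg.cases) auto

lemma is_ty_judg_ren: "is_ty_judg (ren_judg \<sigma> J) \<longleftrightarrow> is_ty_judg J"
  by (cases J rule: is_ty_judg.cases) (simp_all add: ren_judg_def)

lemma is_tm_judg_ren: "is_tm_judg (ren_judg \<sigma> J) \<longleftrightarrow> is_tm_judg J"
  by (cases J rule: is_tm_judg.cases) (simp_all add: ren_judg_def)

lemma degree_ren: "degree (ren_judg \<sigma> J) = degree J"
  by (simp add: degree_def ren_judg_def ren_ctx_def)

lemma alpha_eq_invariants:
  assumes "alpha_eq J K"
  shows "is_ty_judg J = is_ty_judg K" "is_tm_judg J = is_tm_judg K" "degree J = degree K"
  using assms unfolding alpha_eq_def by (auto simp: is_ty_judg_ren is_tm_judg_ren degree_ren)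

lemma derived_ren: "derived \<Lambda> J \<Longrightarrow> bij \<sigma> \<Longrightarrow> derived \<Lambda> (ren_judg \<sigma> J)"
  using derived.alpha[of \<Lambda> "fst J" "snd J" \<sigma>] by (simp add: ren_judg_def)

text \<open>
  The pointwise form is the one to compare with the definition of equivalence, which lists
  the types of the two contexts position by position.
\<close>

lemma alpha_eq_iff_renaming:
  shows "alpha_eq (\<Gamma>, R) (\<Delta>, R') \<longleftrightarrow> length \<Gamma> = length \<Delta> \<and>
    (\<exists>\<sigma>. bij \<sigma> \<and> map \<sigma> (map fst \<Delta>) = map fst \<Gamma> \<and>
      map snd \<Gamma> = map (ren \<sigma>) (map snd \<Delta>) \<and> R = ren_rhs \<sigma> R')"
proof -
  have "\<Gamma> = ren_ctx \<sigma> \<Delta> \<longleftrightarrow> length \<Gamma> = length \<Delta> \<and> map \<sigma> (map fst \<Delta>) = map fst \<Gamma> \<and>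
      map snd \<Gamma> = map (ren \<sigma>) (map snd \<Delta>)" for \<sigma>
  proof
    assume "length \<Gamma> = length \<Delta> \<and> map \<sigma> (map fst \<Delta>) = map fst \<Gamma> \<and>
      map snd \<Gamma> = map (ren \<sigma>) (map snd \<Delta>)"
    then show "\<Gamma> = ren_ctx \<sigma> \<Delta>"
      by (intro pair_list_eqI) (simp_all add: ren_ctx_def split_def comp_def)
  qed (simp add: ren_ctx_def split_def comp_def)
  then show ?thesis
    unfolding alpha_eq_def ren_judg_def by simp blast
qed

text \<open>
  The substitution in the definition of equivalence touches only the first \<open>i\<close> variables of the
  context, but these include all variables of the type at position \<open>i\<close>, so it acts there as the
  full renaming.
\<close>

lemma rename_to_path_type:
  assumes "path_ctx X \<Delta>" "path_type X \<Delta> T" "i \<le> length \<Delta>" "map \<sigma> (map fst \<Delta>) = map fst \<Gamma>"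
  shows "rename_to (map fst (take i \<Delta>)) (map fst (take i \<Gamma>)) ((map snd \<Delta> @ [T]) ! i) =
    ren \<sigma> ((map snd \<Delta> @ [T]) ! i)"
proof -
  have "map fst (take i \<Gamma>) = map \<sigma> (map fst (take i \<Delta>))"
    using assms(4) by (metis take_map)
  moreover have "fv ((map snd \<Delta> @ [T]) ! i) \<subseteq> set (map fst (take i \<Delta>))"
    using path_ctx_prefix[OF assms(1-3)] fv_path_type_subset by fastforce
  ultimately show ?thesis
    by (simp only: rename_to_eq_ren)
qed

lemma ty_equiv_iff_alpha_eq:
  assumes X: "presheaf X"
  shows "ty_equiv (G X) = {(J, K). derived (axioms (G X)) J \<and> derived (axioms (G X)) K \<and>
    is_ty_judg J \<and> alpha_eq J K}" (is "_ = ?R")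
proof (rule set_eqI, rule iffI)
  fix p
  assume "p \<in> ty_equiv (G X)"
  then obtain \<Gamma> S \<Delta> T where p: "p = ((\<Gamma>, IsTy S), (\<Delta>, IsTy T))"
    and der: "derived (axioms (G X)) (\<Gamma>, IsTy S)" "derived (axioms (G X)) (\<Delta>, IsTy T)"
    and len: "length \<Gamma> = length \<Delta>"
    and eq: "\<forall>i\<le>length \<Gamma>. derived (axioms (G X)) (take i \<Gamma>, EqTy ((map snd \<Gamma> @ [S]) ! i)
        (rename_to (map fst (take i \<Delta>)) (map fst (take i \<Gamma>)) ((map snd \<Delta> @ [T]) ! i)))"
    by (auto simp: ty_equiv_def)
  have path: "path_ctx X \<Gamma>" "path_ctx X \<Delta>" "path_type X \<Delta> T"
    using der by (simp_all add: derived_iff_path[OF X])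
  obtain \<sigma> where \<sigma>: "bij \<sigma>" "map \<sigma> (map fst \<Delta>) = map fst \<Gamma>"
    using ex_bij_map_eq[of "map fst \<Delta>" "map fst \<Gamma>"] path path_ctx_distinct len by auto
  have *: "(map snd \<Gamma> @ [S]) ! i = ren \<sigma> ((map snd \<Delta> @ [T]) ! i)" if "i \<le> length \<Gamma>" for i
    using eq that rename_to_path_type[OF path(2,3) _ \<sigma>(2), of i] len
    by (simp add: derived_iff_path[OF X])
  have "map snd \<Gamma> @ [S] = map (ren \<sigma>) (map snd \<Delta> @ [T])"
    by (rule nth_equalityI) (use * len in \<open>auto simp: less_Suc_eq_le simp del: map_append\<close>)
  then have "alpha_eq (\<Gamma>, IsTy S) (\<Delta>, IsTy T)"
    using len \<sigma> by (auto simp: alpha_eq_iff_renaming)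
  then show "p \<in> ?R" using p der by simp
next
  fix p
  assume "p \<in> ?R"
  then obtain \<Gamma> S \<Delta> T where p: "p = ((\<Gamma>, IsTy S), (\<Delta>, IsTy T))"
    and der: "derived (axioms (G X)) (\<Gamma>, IsTy S)" "derived (axioms (G X)) (\<Delta>, IsTy T)"
    and alpha: "alpha_eq (\<Gamma>, IsTy S) (\<Delta>, IsTy T)"
    using alpha_eq_invariants(1) by (fastforce simp: is_ty_judg_iff)
  have path: "path_ctx X \<Gamma>" "path_type X \<Gamma> S" "path_ctx X \<Delta>" "path_type X \<Delta> T"
    using der by (simp_all add: derived_iff_path[OF X])
  obtain \<sigma> where len: "length \<Gamma> = length \<Delta>" and \<sigma>: "map \<sigma> (map fst \<Delta>) = map fst \<Gamma>"
    "map snd \<Gamma> @ [S] = map (ren \<sigma>) (map snd \<Delta> @ [T])"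
    using alpha by (auto simp: alpha_eq_iff_renaming)
  have "derived (axioms (G X)) (take i \<Gamma>, EqTy ((map snd \<Gamma> @ [S]) ! i)
        (rename_to (map fst (take i \<Delta>)) (map fst (take i \<Gamma>)) ((map snd \<Delta> @ [T]) ! i)))"
    if i: "i \<le> length \<Gamma>" for i
  proof -
    have "(map snd \<Gamma> @ [S]) ! i = ren \<sigma> ((map snd \<Delta> @ [T]) ! i)"
      unfolding \<sigma>(2) using i len by (subst nth_map) auto
    then show ?thesis
      using rename_to_path_type[OF path(3,4) _ \<sigma>(1), of i] path_ctx_prefix[OF path(1,2) i] i len
      by (simp add: derived_iff_path[OF X])
  qed
  then show "p \<in> ty_equiv (G X)"
    unfolding ty_equiv_def p using der len by blast
qed

lemma tm_equiv_iff_alpha_eq: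
  assumes X: "presheaf X"
  shows "tm_equiv (G X) = {(J, K). derived (axioms (G X)) J \<and> derived (axioms (G X)) K \<and>
    is_tm_judg J \<and> alpha_eq J K}" (is "_ = ?R")
proof -
  have *: "((\<Gamma>, IsTy S), (\<Delta>, IsTy T)) \<in> ty_equiv (G X) \<and>
      derived (axioms (G X)) (\<Gamma>, EqTm s (rename_to (map fst \<Delta>) (map fst \<Gamma>) t) S) \<longleftrightarrow>
      alpha_eq (\<Gamma>, HasTy s S) (\<Delta>, HasTy t T)"
    if der: "derived (axioms (G X)) (\<Gamma>, HasTy s S)" "derived (axioms (G X)) (\<Delta>, HasTy t T)"
    for \<Gamma> s S \<Delta> t T
  proof -
    have path: "path_ctx X \<Gamma>" "path_rhs X \<Gamma> (HasTy s S)" "path_ctx X \<Delta>"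
        "path_rhs X \<Delta> (HasTy t T)"
      using der by (simp_all add: derived_iff_path[OF X])
    have t: "rename_to (map fst \<Delta>) (map fst \<Gamma>) t = ren \<sigma> t"
      if "map \<sigma> (map fst \<Delta>) = map fst \<Gamma>" for \<sigma>
      using rename_to_eq_ren[of t "map fst \<Delta>" \<sigma>] fv_path_rhs_subset[OF path(3,4)] that by simp
    have "((\<Gamma>, IsTy S), (\<Delta>, IsTy T)) \<in> ty_equiv (G X) \<longleftrightarrow> alpha_eq (\<Gamma>, IsTy S) (\<Delta>, IsTy T)"
      using path by (simp add: ty_equiv_iff_alpha_eq[OF X] derived_iff_path[OF X])
    moreover have "derived (axioms (G X))
        (\<Gamma>, EqTm s (rename_to (map fst \<Delta>) (map fst \<Gamma>) t) S) \<longleftrightarrow>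
        s = rename_to (map fst \<Delta>) (map fst \<Gamma>) t"
      using path by (auto simp: derived_iff_path[OF X])
    ultimately show ?thesis
      using t unfolding alpha_eq_iff_renaming
      by (auto simp del: map_map map_eq_conv) metis+
  qed
  show ?thesis
  proof (rule set_eqI, rule iffI)
    fix p
    assume "p \<in> tm_equiv (G X)"
    then show "p \<in> ?R"
      unfolding tm_equiv_def using * by force
  next
    fix p
    assume "p \<in> ?R"
    then obtain \<Gamma> s S \<Delta> t T where p: "p = ((\<Gamma>, HasTy s S), (\<Delta>, HasTy t T))"
      and der: "derived (axioms (G X)) (\<Gamma>, HasTy s S)" "derived (axioms (G X)) (\<Delta>, HasTy t T)"
      and alpha: "alpha_eq (\<Gamma>, HasTy s S) (\<Delta>, HasTy t T)"
      using alpha_eq_invariants(2) by (fastforce simp: is_tm_judg_iff)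
    then show "p \<in> tm_equiv (G X)"
      using *[OF der] unfolding tm_equiv_def by blast
  qed
qed

lemma equiv_alpha_eq:
  assumes P: "\<And>J K. alpha_eq J K \<Longrightarrow> P J = P K"
  shows "equiv {J. derived \<Lambda> J \<and> P J}
    {(J, K). derived \<Lambda> J \<and> derived \<Lambda> K \<and> P J \<and> alpha_eq J K}" (is "equiv ?A ?r")
proof (rule equivI)
  have "(J, K) \<in> ?A \<times> ?A" if "(J, K) \<in> ?r" for J K
    using that P[of J K] by simp
  then show "?r \<subseteq> ?A \<times> ?A"
    by (rule subrelI)
  show "refl_on ?A ?r"
    by (rule refl_onI) (simp add: alpha_eq_refl)
  show "sym ?r"
  proof (rule symI)
    fix J K
    assume "(J, K) \<in> ?r"
    then show "(K, J) \<in> ?r"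
      using alpha_eq_sym[of J K] P[of J K] by simp
  qed
  show "trans ?r"
  proof (rule transI)
    fix I J K
    assume "(I, J) \<in> ?r" "(J, K) \<in> ?r"
    then show "(I, K) \<in> ?r"
      using alpha_eq_trans[of I J K] by simp
  qed
qed

lemma equiv_ty_equiv:
  assumes X: "presheaf X"
  shows "equiv {J. derived (axioms (G X)) J \<and> is_ty_judg J} (ty_equiv (G X))"
  unfolding ty_equiv_iff_alpha_eq[OF X]
  by (rule equiv_alpha_eq) (rule alpha_eq_invariants(1))

lemma equiv_tm_equiv:
  assumes X: "presheaf X"
  shows "equiv {J. derived (axioms (G X)) J \<and> is_tm_judg J} (tm_equiv (G X))"
  unfolding tm_equiv_iff_alpha_eq[OF X]
  by (rule equiv_alpha_eq) (rule alpha_eq_invariants(2))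

lemma ty_class_eq_iff:
  assumes X: "presheaf X" and JK: "derived (axioms (G X)) J" "derived (axioms (G X)) K"
    "is_ty_judg J" "is_ty_judg K"
  shows "ty_equiv (G X) `` {J} = ty_equiv (G X) `` {K} \<longleftrightarrow> alpha_eq J K"
proof -
  have "ty_equiv (G X) `` {J} = ty_equiv (G X) `` {K} \<longleftrightarrow> (J, K) \<in> ty_equiv (G X)"
    by (rule eq_equiv_class_iff[OF equiv_ty_equiv[OF X]]) (simp_all add: JK)
  also have "\<dots> \<longleftrightarrow> alpha_eq J K"
    using JK by (simp add: ty_equiv_iff_alpha_eq[OF X])
  finally show ?thesis .
qed

lemma tm_class_eq_iff:
  assumes X: "presheaf X" and JK: "derived (axioms (G X)) J" "derived (axioms (G X)) K"
    "is_tm_judg J" "is_tm_judg K"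
  shows "tm_equiv (G X) `` {J} = tm_equiv (G X) `` {K} \<longleftrightarrow> alpha_eq J K"
proof -
  have "tm_equiv (G X) `` {J} = tm_equiv (G X) `` {K} \<longleftrightarrow> (J, K) \<in> tm_equiv (G X)"
    by (rule eq_equiv_class_iff[OF equiv_tm_equiv[OF X]]) (simp_all add: JK)
  also have "\<dots> \<longleftrightarrow> alpha_eq J K"
    using JK by (simp add: tm_equiv_iff_alpha_eq[OF X])
  finally show ?thesis .
qed

section \<open>Canonical representatives\<close>

definition canonical :: "'c judg \<Rightarrow> bool" where
  "canonical J \<longleftrightarrow> map fst (fst J) = [1..<degree J]"

lemma ex_canonical:
  assumes X: "presheaf X" and J: "derived (axioms (G X)) J"
  shows "\<exists>K. derived (axioms (G X)) K \<and> canonical K \<and> alpha_eq K J"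
proof -
  have "path_ctx X (fst J)"
    using derived_imp_path[OF X J] by blast
  then have "distinct (map fst (fst J))"
    by (rule path_ctx_distinct)
  moreover have "length (map fst (fst J)) = length [1..<degree J]"
    by (simp add: degree_def del: upt_Suc)
  ultimately obtain \<sigma> where \<sigma>: "bij \<sigma>" "map \<sigma> (map fst (fst J)) = [1..<degree J]"
    using ex_bij_map_eq[of "map fst (fst J)" "[1..<degree J]"] by auto
  then have "canonical (ren_judg \<sigma> J)"
    unfolding canonical_def degree_ren by (simp add: ren_judg_def map_fst_ren_ctx)
  moreover have "alpha_eq (ren_judg \<sigma> J) J"
    using \<sigma>(1) by (auto simp: alpha_eq_def)
  ultimately show ?thesis
    using derived_ren[OF J \<sigma>(1)] by blast
qed

lemma ren_rhs_ident:
  assumes "path_ctx X \<Gamma>" "path_rhs X \<Gamma> R" "\<And>x. x \<in> ctx_vars \<Gamma> \<Longrightarrow> \<sigma> x = x"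
  shows "ren_rhs \<sigma> R = R"
proof -
  have T: "ren \<sigma> T = T" if "path_type X \<Gamma> T" for T
    using fv_path_type_subset[OF assms(1) that] assms(3) by (blast intro: ren_ident)
  have "ren \<sigma> t = t" if "path_type X \<Gamma> T" "path_term X t T" for t T
    using fv_path_rhs_subset[OF assms(1), of t T] assms(3) that
    by (auto intro!: ren_ident)
  with T assms(2) show ?thesis by (cases R) auto
qed

text \<open>
  A renaming between two canonical judgements fixes all declared variables, and a derived
  judgement has no other variables.
\<close>

lemma canonical_unique:
  assumes X: "presheaf X" and J: "derived (axioms (G X)) J" and K: "derived (axioms (G X)) K"
    and can: "canonical J" "canonical K" and "alpha_eq J K"
  shows "J = K"
proof -
  obtain \<Gamma> R where K_eq: "K = (\<Gamma>, R)" by (cases K)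
  from assms(6) obtain \<sigma> where J_eq: "J = ren_judg \<sigma> K"
    by (auto simp: alpha_eq_def)
  have path: "path_ctx X \<Gamma>" "path_rhs X \<Gamma> R"
    using K K_eq by (simp_all add: derived_iff_path[OF X])
  have "map fst \<Gamma> = [1..<degree K]"
    using can(2) K_eq by (simp add: canonical_def)
  moreover have "map \<sigma> (map fst \<Gamma>) = [1..<degree K]"
    using can(1) K_eq unfolding canonical_def J_eq degree_ren
    by (simp add: ren_judg_def map_fst_ren_ctx)
  ultimately have "map \<sigma> (map fst \<Gamma>) = map fst \<Gamma>" by simp
  then have id: "\<sigma> x = x" if "x \<in> ctx_vars \<Gamma>" for x
    using that by auto
  have "(\<sigma> x, ren \<sigma> T) = (x, T)" if "(x, T) \<in> set \<Gamma>" for x T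
    using ren_rhs_ident[OF path(1), of "IsTy T" \<sigma>] path_ctx_type[OF path(1) that] id that
    by force
  then have "ren_ctx \<sigma> \<Gamma> = \<Gamma>"
    unfolding ren_ctx_def by (intro map_idI) auto
  then show ?thesis
    using ren_rhs_ident[OF path] id K_eq J_eq by (simp add: ren_judg_def)
qed

lemma bij_betw_canonical_class:
  assumes X: "presheaf X"
  shows "bij_betw (\<lambda>J. ty_equiv (G X) `` {J})
    {J. derived (axioms (G X)) J \<and> is_ty_judg J \<and> degree J = n \<and> canonical J} (ty_el (W X) n)"
    (is "bij_betw ?f ?C ?Q")
  unfolding bij_betw_def
proof
  show "inj_on ?f ?C"
  proof (rule inj_onI)
    fix J K
    assume "J \<in> ?C" "K \<in> ?C" "?f J = ?f K"
    then show "J = K"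
      using ty_class_eq_iff[OF X, of J K] canonical_unique[OF X, of J K] by simp
  qed
  have "?f K \<in> ?f ` ?C" if K: "derived (axioms (G X)) K" "is_ty_judg K" "degree K = n" for K
  proof -
    obtain J where J: "derived (axioms (G X)) J" "canonical J" "alpha_eq J K"
      using ex_canonical[OF X K(1)] by blast
    then have "J \<in> ?C" "?f J = ?f K"
      using K alpha_eq_invariants[OF J(3)] by (auto simp: ty_class_eq_iff[OF X])
    then show ?thesis by (intro image_eqI[of _ _ J]) simp_all
  qed
  then show "?f ` ?C = ?Q"
    by (auto simp: W_def V_def quotient_def)
qed

lemma boundary_ren: "boundary (ren_judg \<sigma> J) = map (ren_judg \<sigma>) (boundary J)"
proof (cases J rule: boundary.cases)
  case (1 \<Gamma> T)
  then show ?thesis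
    by (cases \<Gamma> rule: rev_cases) (simp_all add: ren_judg_def ren_ctx_def split: prod.split)
next
  case (2 \<Gamma> t T)
  then show ?thesis by (simp add: ren_judg_def)
next
  case (3 \<Gamma> T T')
  then show ?thesis by (simp add: ren_judg_def)
next
  case (4 \<Gamma> t t' T)
  then show ?thesis by (simp add: ren_judg_def)
qed

text \<open>
  Taking boundaries commutes with renaming, so all members of a class have equivalent
  boundaries, and the union that defines the boundary of a class is the class of the boundary
  of any one member.
\<close>

lemma class_boundary:
  assumes X: "presheaf X" and r: "r = ty_equiv (G X) \<or> r = tm_equiv (G X)" and J: "(J, J) \<in> r"
    and bd: "boundary J = [K]" and K: "derived (axioms (G X)) K" "is_ty_judg K"
  shows "(\<Union>J'\<in>r `` {J}. ty_equiv (G X) `` set (boundary J')) = ty_equiv (G X) `` {K}"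
proof -
  have "ty_equiv (G X) `` set (boundary J') = ty_equiv (G X) `` {K}" if "(J, J') \<in> r" for J'
  proof -
    have "alpha_eq J J'"
      using r that by (auto simp: ty_equiv_iff_alpha_eq[OF X] tm_equiv_iff_alpha_eq[OF X])
    then obtain \<sigma> where \<sigma>: "bij \<sigma>" "J' = ren_judg \<sigma> J"
      using alpha_eq_sym[of J J'] by (auto simp: alpha_eq_def)
    have "boundary J' = [ren_judg \<sigma> K]"
      using bd \<sigma>(2) by (simp add: boundary_ren)
    moreover have "ty_equiv (G X) `` {ren_judg \<sigma> K} = ty_equiv (G X) `` {K}"
      using \<sigma>(1) K derived_ren[OF K(1) \<sigma>(1)]
      by (subst ty_class_eq_iff[OF X]) (auto simp: is_ty_judg_ren alpha_eq_def)
    ultimately show ?thesis by simp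
  qed
  then show ?thesis using J by blast
qed

section \<open>Heaps as canonical judgements\<close>

lemma Hp_bound: "\<phi> \<in> Hp n \<Longrightarrow> 1 \<le> i \<Longrightarrow> i \<le> n \<Longrightarrow> \<phi> i < i"
  by (auto simp: Hp_def)

lemma HpI:
  assumes "\<phi> \<in> extensional {0..n}" "\<phi> 0 = 0" "\<And>i. 1 \<le> i \<Longrightarrow> i \<le> n \<Longrightarrow> \<phi> i < i"
  shows "\<phi> \<in> Hp n"
proof -
  have "\<phi> i \<in> {0..n}" if "i \<in> {0..n}" for i
    using that assms(2) assms(3)[of i] by (cases "i = 0") auto
  then show ?thesis
    using assms by (simp add: Hp_def PiE_iff)
qed

lemma funpow_zero: "\<phi> 0 = 0 \<Longrightarrow> (\<phi> ^^ k) 0 = 0" for \<phi> :: "nat \<Rightarrow> nat"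
  by (induction k) auto

lemma Hp_funpow_less:
  assumes "\<phi> \<in> Hp n" "1 \<le> i" "i \<le> n" "1 \<le> k"
  shows "(\<phi> ^^ k) i < i"
  using assms(4)
proof (induction k rule: dec_induct)
  case base
  then show ?case using Hp_bound[OF assms(1-3)] by simp
next
  case (step k)
  show ?case
  proof (cases "(\<phi> ^^ k) i = 0")
    case True
    then show ?thesis using assms by (simp add: Hp_def)
  next
    case False
    then show ?thesis
      using Hp_bound[OF assms(1), of "(\<phi> ^^ k) i"] step.IH assms(3) by simp
  qed
qed

text \<open>
  The depth is defined by counting distinct iterates. Below \<open>i\<close> the iterates strictly decrease
  until they reach 0, so none is counted twice and the count grows by one at each node whose
  parent is not the root 0. The root itself has depth 1, as its only iterate is 0, so nodes
  whose parent is the root need a separate case.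
\<close>

lemma dp_rec:
  assumes \<phi>: "\<phi> \<in> Hp n" and i: "1 \<le> i" "i \<le> n"
  shows "dp \<phi> i = (if \<phi> i = 0 then 1 else Suc (dp \<phi> (\<phi> i)))"
proof -
  let ?D = "\<lambda>i. (\<lambda>k. (\<phi> ^^ k) i) ` {1..}"
  have le: "\<phi> i \<le> n"
    using Hp_bound[OF \<phi> i] i by simp
  have "{1 :: nat..} = insert 1 (Suc ` {1..})"
  proof (rule set_eqI)
    show "k \<in> {1 :: nat..} \<longleftrightarrow> k \<in> insert 1 (Suc ` {1..})" for k
      by (cases k) (auto simp: inj_image_mem_iff)
  qed
  then have "?D i = (\<lambda>k. (\<phi> ^^ k) i) ` insert 1 (Suc ` {1..})"
    by (rule arg_cong)
  also have "\<dots> = insert (\<phi> i) (?D (\<phi> i))"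
    by (simp add: image_image funpow_Suc_right del: funpow.simps(2))
  finally have D: "?D i = insert (\<phi> i) (?D (\<phi> i))" .
  show ?thesis
  proof (cases "\<phi> i = 0")
    case True
    have "\<phi> 0 = 0"
      using \<phi> by (simp add: Hp_def)
    then have "?D (\<phi> i) = {0}"
      by (auto simp: True funpow_zero)
    then show ?thesis using D True by (simp add: dp_def)
  next
    case False
    have *: "x < \<phi> i" if "x \<in> ?D (\<phi> i)" for x
      using that Hp_funpow_less[OF \<phi>, of "\<phi> i"] le False by auto
    then have "?D (\<phi> i) \<subseteq> {..<\<phi> i}" by blast
    then have "finite (?D (\<phi> i))" by (rule finite_subset) simp
    moreover have "\<phi> i \<notin> ?D (\<phi> i)" using * by blast
    ultimately show ?thesis using D False by (simp add: dp_def)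
  qed
qed

lemma path_vars_rec:
  assumes \<phi>: "\<phi> \<in> Hp n" and i: "1 \<le> i" "i \<le> n"
  shows "path_vars \<phi> i = (if \<phi> i = 0 then [] else path_vars \<phi> (\<phi> i) @ [Var (\<phi> i)])"
proof (cases "\<phi> i = 0")
  case True
  then show ?thesis by (simp add: path_vars_def dp_rec[OF assms])
next
  case False
  let ?d = "dp \<phi> (\<phi> i)"
  have "?d \<ge> 1"
    using dp_rec[OF \<phi>, of "\<phi> i"] False Hp_bound[OF \<phi> i] i by simp
  moreover have "(\<phi> ^^ (Suc ?d - l)) i = (\<phi> ^^ (?d - l)) (\<phi> i)" if "l \<le> ?d" for l
    using that by (simp add: Suc_diff_le funpow_Suc_right del: funpow.simps(2))
  ultimately show ?thesis
    using False by (simp add: path_vars_def dp_rec[OF assms])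
qed

lemma dp_pos: "\<phi> \<in> Hp n \<Longrightarrow> 1 \<le> i \<Longrightarrow> i \<le> n \<Longrightarrow> 1 \<le> dp \<phi> i"
  by (simp add: dp_rec)

lemma path_vars_eq_Var: "\<exists>ys. path_vars \<phi> i = map Var ys"
proof
  show "path_vars \<phi> i = map Var (map (\<lambda>l. (\<phi> ^^ (dp \<phi> i - l)) i) [1..<dp \<phi> i])"
    by (simp add: path_vars_def)
qed

lemma heap_bd_Hp:
  assumes \<phi>: "\<phi> \<in> Hp (Suc n)"
  shows "heap_bd n \<phi> \<in> Hp n"
proof (rule HpI)
  show "heap_bd n \<phi> 0 = 0"
    using \<phi> by (simp add: heap_bd_def Hp_def)
  show "heap_bd n \<phi> i < i" if "1 \<le> i" "i \<le> n" for i
    using Hp_bound[OF \<phi>, of i] that by (simp add: heap_bd_def)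
qed (simp add: heap_bd_def)

lemma dp_path_vars_heap_bd:
  assumes \<phi>: "\<phi> \<in> Hp (Suc n)" and i: "1 \<le> i" "i \<le> n"
  shows "dp (heap_bd n \<phi>) i = dp \<phi> i \<and>
    (path_vars (heap_bd n \<phi>) i :: 'c expr list) = path_vars \<phi> i"
  using i
proof (induction i rule: less_induct)
  case (less i)
  have [simp]: "heap_bd n \<phi> i = \<phi> i"
    using less.prems by (simp add: heap_bd_def)
  show ?case
    using less.IH[of "\<phi> i"] Hp_bound[OF \<phi>, of i] less.prems
      dp_rec[OF \<phi>, of i] dp_rec[OF heap_bd_Hp[OF \<phi>], of i]
      path_vars_rec[OF \<phi>, of i, where ?'a = 'c]
      path_vars_rec[OF heap_bd_Hp[OF \<phi>], of i, where ?'a = 'c] by simp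
qed

text \<open>
  Since heaps carry no term-elements, a map out of \<open>[\<phi>]\<close> is the same as a family of values
  compatible with the boundaries.
\<close>

definition heap_family :: "('a, 'b) tts \<Rightarrow> nat \<Rightarrow> (nat \<Rightarrow> nat) \<Rightarrow> (nat \<Rightarrow> 'a) \<Rightarrow> bool" where
  "heap_family X n \<phi> v \<longleftrightarrow> (\<forall>i\<in>{1..n}. v i \<in> ty_el X (dp \<phi> i) \<and>
     (\<phi> i \<noteq> 0 \<longrightarrow> v (\<phi> i) = bd X (dp \<phi> (\<phi> i)) (v i)))"

lemma psh_hom_heap_psh_iff:
  "h \<in> psh_hom (heap_psh n \<phi>) X \<longleftrightarrow>
     fst h \<in> (\<Pi>\<^sub>E m\<in>{1..}. {i \<in> {1..n}. dp \<phi> i = m} \<rightarrow>\<^sub>E ty_el X m) \<and>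
     snd h \<in> (\<Pi>\<^sub>E m\<in>{1..}. {} \<rightarrow>\<^sub>E tm_el X m) \<and>
     (\<forall>m\<ge>1. \<forall>i\<in>{1..n}. dp \<phi> i = Suc m \<longrightarrow> fst h m (\<phi> i) = bd X m (fst h (Suc m) i))"
  by (cases h) (auto simp: psh_hom_def heap_psh_def)

definition family_hom :: "nat \<Rightarrow> (nat \<Rightarrow> nat) \<Rightarrow> (nat \<Rightarrow> 'a) \<Rightarrow> ('a, 'b) heap_map" where
  "family_hom n \<phi> v = ((\<lambda>m\<in>{1..}. \<lambda>i\<in>{i \<in> {1..n}. dp \<phi> i = m}. v i),
     (\<lambda>m\<in>{1..}. \<lambda>x\<in>{}. undefined))"

lemma heap_val_family_hom:
  assumes "\<phi> \<in> Hp n" "1 \<le> i" "i \<le> n"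
  shows "heap_val \<phi> (family_hom n \<phi> v) i = v i"
  using assms dp_pos[OF assms] by (simp add: heap_val_def family_hom_def)

lemma family_hom_in_psh_hom:
  fixes X :: "('a, 'b) tts"
  assumes \<phi>: "\<phi> \<in> Hp n" and v: "heap_family X n \<phi> v"
  shows "family_hom n \<phi> v \<in> psh_hom (heap_psh n \<phi>) X"
  unfolding psh_hom_heap_psh_iff
proof (intro conjI allI impI ballI)
  show "fst (family_hom n \<phi> v) \<in> (\<Pi>\<^sub>E m\<in>{1..}. {i \<in> {1..n}. dp \<phi> i = m} \<rightarrow>\<^sub>E ty_el X m)"
    using v by (auto simp only: family_hom_def fst_conv restrict_PiE_iff heap_family_def)
  show "snd (family_hom n \<phi> v) \<in> (\<Pi>\<^sub>E m\<in>{1..}. {} \<rightarrow>\<^sub>E tm_el X m)"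
    by (simp add: family_hom_def restrict_PiE_iff)
  fix m i
  assume m: "1 \<le> m" and i: "i \<in> {1..n}" "dp \<phi> i = Suc m"
  then have "v (\<phi> i) = bd X m (v i)" "1 \<le> \<phi> i" "\<phi> i \<le> n" "dp \<phi> (\<phi> i) = m"
    using v dp_rec[OF \<phi>, of i] Hp_bound[OF \<phi>, of i]
    by (auto simp: heap_family_def split: if_splits)
  then show "fst (family_hom n \<phi> v) m (\<phi> i) = bd X m (fst (family_hom n \<phi> v) (Suc m) i)"
    using m i by (simp add: family_hom_def)
qed

lemma heap_family_heap_val:
  assumes \<phi>: "\<phi> \<in> Hp n" and h: "h \<in> psh_hom (heap_psh n \<phi>) X"
  shows "heap_family X n \<phi> (heap_val \<phi> h)"
  unfolding heap_family_def
proof (intro ballI conjI impI)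
  fix i
  assume i: "i \<in> {1..n}"
  have d: "1 \<le> dp \<phi> i" using dp_pos[OF \<phi>] i by simp
  show "heap_val \<phi> h i \<in> ty_el X (dp \<phi> i)"
    using h i d by (auto simp: psh_hom_heap_psh_iff heap_val_def PiE_iff)
  assume "\<phi> i \<noteq> 0"
  then have "dp \<phi> i = Suc (dp \<phi> (\<phi> i))" "1 \<le> dp \<phi> (\<phi> i)"
    using dp_rec[OF \<phi>, of i] dp_pos[OF \<phi>, of "\<phi> i"] Hp_bound[OF \<phi>, of i] i by auto
  then show "heap_val \<phi> h (\<phi> i) = bd X (dp \<phi> (\<phi> i)) (heap_val \<phi> h i)"
    using h i by (auto simp: psh_hom_heap_psh_iff heap_val_def)
qed

lemma heap_hom_eqI:
  assumes h: "h \<in> psh_hom (heap_psh n \<phi>) X" and h': "h' \<in> psh_hom (heap_psh n \<phi>) X"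
    and eq: "\<And>i. 1 \<le> i \<Longrightarrow> i \<le> n \<Longrightarrow> heap_val \<phi> h i = heap_val \<phi> h' i"
  shows "h = h'"
proof (rule prod_eqI)
  let ?D = "\<lambda>m. {i \<in> {1..n}. dp \<phi> i = m}"
  have fst: "fst h \<in> (\<Pi>\<^sub>E m\<in>{1..}. ?D m \<rightarrow>\<^sub>E ty_el X m)" "fst h' \<in> (\<Pi>\<^sub>E m\<in>{1..}. ?D m \<rightarrow>\<^sub>E ty_el X m)"
    and snd: "snd h \<in> (\<Pi>\<^sub>E m\<in>{1..}. {} \<rightarrow>\<^sub>E tm_el X m)" "snd h' \<in> (\<Pi>\<^sub>E m\<in>{1..}. {} \<rightarrow>\<^sub>E tm_el X m)"
    using h h' unfolding psh_hom_heap_psh_iff by blast+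
  show "fst h = fst h'"
  proof (rule PiE_ext[OF fst])
    fix m :: nat
    assume m: "m \<in> {1..}"
    show "fst h m = fst h' m"
    proof (rule PiE_ext[OF PiE_mem[OF fst(1) m] PiE_mem[OF fst(2) m]])
      fix i
      assume "i \<in> ?D m"
      then show "fst h m i = fst h' m i"
        using eq[of i] by (simp add: heap_val_def)
    qed
  qed
  show "snd h = snd h'"
  proof (rule PiE_ext[OF snd])
    fix m :: nat
    assume m: "m \<in> {1..}"
    show "snd h m = snd h' m"
      by (rule PiE_ext[OF PiE_mem[OF snd(1) m] PiE_mem[OF snd(2) m]]) simp
  qed
qed

lemma hom_restrict_heap_bd:
  assumes \<phi>: "\<phi> \<in> Hp (Suc n)" and h: "h \<in> psh_hom (heap_psh (Suc n) \<phi>) X"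
  shows "hom_restrict h (heap_psh n (heap_bd n \<phi>)) \<in> psh_hom (heap_psh n (heap_bd n \<phi>)) X"
    and "\<And>i. 1 \<le> i \<Longrightarrow> i \<le> n \<Longrightarrow>
      heap_val (heap_bd n \<phi>) (hom_restrict h (heap_psh n (heap_bd n \<phi>))) i = heap_val \<phi> h i"
proof -
  let ?\<psi> = "heap_bd n \<phi>"
  have \<psi>: "?\<psi> \<in> Hp n" by (rule heap_bd_Hp[OF \<phi>])
  have dp: "dp ?\<psi> i = dp \<phi> i" if "1 \<le> i" "i \<le> n" for i
    using dp_path_vars_heap_bd[OF \<phi> that] by blast
  have par: "?\<psi> i = \<phi> i" "\<phi> i < i" if "1 \<le> i" "i \<le> n" for i
    using that Hp_bound[OF \<phi>, of i] by (auto simp: heap_bd_def)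
  show val: "heap_val ?\<psi> (hom_restrict h (heap_psh n ?\<psi>)) i = heap_val \<phi> h i"
    if "1 \<le> i" "i \<le> n" for i
    using that dp dp_pos[OF \<psi> that] by (simp add: heap_val_def hom_restrict_def heap_psh_def)
  have "heap_family X n ?\<psi> (heap_val \<phi> h)"
    unfolding heap_family_def
  proof
    fix i
    assume "i \<in> {1..n}"
    then show "heap_val \<phi> h i \<in> ty_el X (dp ?\<psi> i) \<and>
        (?\<psi> i \<noteq> 0 \<longrightarrow> heap_val \<phi> h (?\<psi> i) = bd X (dp ?\<psi> (?\<psi> i)) (heap_val \<phi> h i))"
      using heap_family_heap_val[OF \<phi> h] dp[of i] dp[of "\<phi> i"] par[of i]
      by (auto simp: heap_family_def)
  qed
  then have "family_hom n ?\<psi> (heap_val \<phi> h) \<in> psh_hom (heap_psh n ?\<psi>) X"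
    by (rule family_hom_in_psh_hom[OF \<psi>])
  moreover have "hom_restrict h (heap_psh n ?\<psi>) = family_hom n ?\<psi> (heap_val \<phi> h)"
    using dp by (auto simp: hom_restrict_def family_hom_def heap_psh_def heap_val_def
        fun_eq_iff restrict_def)
  ultimately show "hom_restrict h (heap_psh n ?\<psi>) \<in> psh_hom (heap_psh n ?\<psi>) X"
    by simp
qed

lemma path_type_heap:
  fixes X :: "('a, 'b) tts"
  assumes \<phi>: "\<phi> \<in> Hp n" and h: "h \<in> psh_hom (heap_psh n \<phi>) X" and i: "1 \<le> i" "i \<le> n"
  shows "path_type X (heap_ctx i \<phi> h) (heap_type \<phi> h i)"
proof -
  have fam: "heap_val \<phi> h i \<in> ty_el X (dp \<phi> i)"
      "\<phi> i \<noteq> 0 \<Longrightarrow> heap_val \<phi> h (\<phi> i) = bd X (dp \<phi> (\<phi> i)) (heap_val \<phi> h i)"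
    using heap_family_heap_val[OF \<phi> h] i by (auto simp: heap_family_def)
  show ?thesis
  proof (cases "\<phi> i = 0")
    case True
    then show ?thesis
      using fam(1) dp_rec[OF \<phi> i] path_vars_rec[OF \<phi> i]
      by (auto simp: path_type_def heap_type_def)
  next
    case False
    have j: "1 \<le> \<phi> i" "\<phi> i < i" using False Hp_bound[OF \<phi> i] by auto
    obtain ys where ys: "(path_vars \<phi> (\<phi> i) :: (nat \<times> 'a + nat \<times> 'b) expr list) = map Var ys"
      using path_vars_eq_Var by blast
    have "(\<phi> i, heap_type \<phi> h (\<phi> i)) \<in> set (heap_ctx i \<phi> h)"
      using j by (auto simp: heap_ctx_def)
    then have "(\<phi> i, App (Inl (dp \<phi> (\<phi> i), bd X (dp \<phi> (\<phi> i)) (heap_val \<phi> h i))) (map Var ys))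
        \<in> set (heap_ctx i \<phi> h)"
      using fam(2)[OF False] ys by (simp add: heap_type_def)
    moreover have "heap_type \<phi> h i =
        App (Inl (Suc (dp \<phi> (\<phi> i)), heap_val \<phi> h i)) (map Var (ys @ [\<phi> i]))"
      using False ys by (simp add: heap_type_def dp_rec[OF \<phi> i] path_vars_rec[OF \<phi> i])
    ultimately show ?thesis
      using fam(1) dp_rec[OF \<phi> i] dp_pos[OF \<phi>, of "\<phi> i"] j i False
      unfolding path_type_def by fastforce
  qed
qed

lemma path_ctx_heap_ctx:
  assumes \<phi>: "\<phi> \<in> Hp n" and h: "h \<in> psh_hom (heap_psh n \<phi>) X" and "i \<le> n"
  shows "path_ctx X (heap_ctx i \<phi> h)"
  using assms(3)
proof (induction i)
  case 0
  then show ?case by (simp add: heap_ctx_def path_ctx.empty)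
next
  case (Suc i)
  show ?case
  proof (cases "i = 0")
    case True
    then show ?thesis by (simp add: heap_ctx_def path_ctx.empty)
  next
    case False
    then have "heap_ctx (Suc i) \<phi> h = heap_ctx i \<phi> h @ [(i, heap_type \<phi> h i)]"
      by (simp add: heap_ctx_def)
    moreover have "i \<notin> ctx_vars (heap_ctx i \<phi> h)"
      by (auto simp: heap_ctx_def)
    ultimately show ?thesis
      using Suc path_type_heap[OF \<phi> h, of i] False by (simp add: path_ctx_snoc)
  qed
qed

text \<open>
  The last argument of each type recovers the parent of the node, and the head its value.
\<close>

lemma heap_type_inj:
  assumes \<phi>: "\<phi> \<in> Hp n" and h: "h \<in> psh_hom (heap_psh n \<phi>) X"
    and \<psi>: "\<psi> \<in> Hp n" and g: "g \<in> psh_hom (heap_psh n \<psi>) X"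
    and eq: "\<And>i. 1 \<le> i \<Longrightarrow> i \<le> n \<Longrightarrow> heap_type \<phi> h i = heap_type \<psi> g i"
  shows "\<phi> = \<psi> \<and> h = g"
proof -
  have "\<phi> i = \<psi> i" if i: "1 \<le> i" "i \<le> n" for i
    using eq[OF i]
    by (auto simp: heap_type_def path_vars_rec[OF \<phi> i] path_vars_rec[OF \<psi> i] split: if_splits)
  then have "\<phi> i = \<psi> i" if "i \<in> {0..n}" for i
    using that \<phi> \<psi> by (cases "i = 0") (auto simp: Hp_def)
  then have "\<phi> = \<psi>"
    using \<phi> \<psi> unfolding Hp_def by (blast intro: PiE_ext)
  moreover from this have "h = g"
    using eq g by (intro heap_hom_eqI[OF h]) (auto simp: heap_type_def)
  ultimately show ?thesis by blast
qed

text \<open>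
  The heap and its map are read off from the types. That the depths and paths of the resulting
  heap are the actual levels and argument lists holds by induction on the position, since
  the arguments before the last one are those of the type of the last argument.
\<close>

lemma canonical_path_judg_eq_heap:
  assumes "path_ctx X \<Gamma>" "path_type X \<Gamma> S" "map fst \<Gamma> = [1..<n]" "1 \<le> n"
  shows "\<exists>\<phi>\<in>Hp n. \<exists>h\<in>psh_hom (heap_psh n \<phi>) X. \<Gamma> = heap_ctx n \<phi> h \<and> S = heap_type \<phi> h n"
proof -
  have len: "Suc (length \<Gamma>) = n"
    using arg_cong[OF assms(3), of length] assms(4) by simp
  define T where "T i = (map snd \<Gamma> @ [S]) ! (i - 1)" for i
  have nth: "\<Gamma> ! k = (Suc k, T (Suc k))" if "k < length \<Gamma>" for k
  proof (rule prod_eqI)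
    have "map fst \<Gamma> ! k = Suc k"
      unfolding assms(3) using that len by simp
    then show "fst (\<Gamma> ! k) = fst (Suc k, T (Suc k))" using that by simp
  qed (use that in \<open>simp add: T_def nth_append\<close>)
  \<comment> \<open>The parent is 0 for an empty path. This is unambiguous because variables are positive.\<close>
  have "\<exists>p A. p < i \<and> (if p = 0 then A \<in> ty_el X 1 \<and> T i = App (Inl (1, A)) []
      else \<exists>m ys. A \<in> ty_el X (Suc m) \<and> T i = App (Inl (Suc m, A)) (map Var (ys @ [p])) \<and>
        T p = App (Inl (m, bd X m A)) (map Var ys))" if i: "i \<in> {1..n}" for i
  proof -
    have "path_type X (take (i - 1) \<Gamma>) (T i)"
      unfolding T_def using path_ctx_prefix[OF assms(1,2), of "i - 1"] i len by auto
    then show ?thesis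
    proof (cases rule: path_type_cases)
      case (root A)
      then show ?thesis using i by (intro exI[of _ 0]) auto
    next
      case (step m A y ys)
      then obtain k where "k < i - 1" "k < length \<Gamma>" 
        "\<Gamma> ! k = (y, App (Inl (m, bd X m A)) (map Var ys))"
        by (auto simp: in_set_conv_nth)
      then have "y = Suc k" "y < i" "T y = App (Inl (m, bd X m A)) (map Var ys)"
        using nth by auto
      then show ?thesis
        using step by (intro exI[of _ y] exI[of _ A]) auto
    qed
  qed
  then obtain p v where pv: "\<And>i. i \<in> {1..n} \<Longrightarrow> p i < i \<and>
      (if p i = 0 then v i \<in> ty_el X 1 \<and> T i = App (Inl (1, v i)) []
       else \<exists>m ys. v i \<in> ty_el X (Suc m) \<and> T i = App (Inl (Suc m, v i)) (map Var (ys @ [p i])) \<and>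
         T (p i) = App (Inl (m, bd X m (v i))) (map Var ys))"
    by metis
  define \<phi> where "\<phi> = (\<lambda>i\<in>{0..n}. if i = 0 then 0 else p i)"
  have \<phi>_eq: "\<phi> i = p i" if "i \<in> {1..n}" for i
    using that by (simp add: \<phi>_def)
  have \<phi>: "\<phi> \<in> Hp n"
    by (rule HpI) (use pv in \<open>auto simp: \<phi>_def\<close>)
  have T_eq: "T i = App (Inl (dp \<phi> i, v i)) (path_vars \<phi> i)" if "i \<in> {1..n}" for i
    using that
  proof (induction i rule: less_induct)
    case (less i)
    then have i: "1 \<le> i" "i \<le> n" by auto
    show ?case
    proof (cases "p i = 0")
      case True
      then show ?thesis
        using pv[OF less.prems] \<phi>_eq[OF less.prems]
        by (simp add: dp_rec[OF \<phi> i] path_vars_rec[OF \<phi> i])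
    next
      case False
      then obtain m ys where "T i = App (Inl (Suc m, v i)) (map Var (ys @ [p i]))"
          "T (p i) = App (Inl (m, bd X m (v i))) (map Var ys)"
        using pv[OF less.prems] by auto
      moreover have "T (p i) = App (Inl (dp \<phi> (p i), v (p i))) (path_vars \<phi> (p i))"
        using less.IH[of "p i"] pv[OF less.prems] False i by auto
      ultimately show ?thesis
        using \<phi>_eq[OF less.prems] False
        by (simp add: dp_rec[OF \<phi> i] path_vars_rec[OF \<phi> i])
    qed
  qed
  have "heap_family X n \<phi> v"
    unfolding heap_family_def
  proof
    fix i
    assume i: "i \<in> {1..n}"
    show "v i \<in> ty_el X (dp \<phi> i) \<and> (\<phi> i \<noteq> 0 \<longrightarrow> v (\<phi> i) = bd X (dp \<phi> (\<phi> i)) (v i))"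
    proof (cases "p i = 0")
      case True
      then show ?thesis
        using pv[OF i] \<phi>_eq[OF i] i by (simp add: dp_rec[OF \<phi>])
    next
      case False
      then have "p i \<in> {1..n}" using pv[OF i] i by auto
      then show ?thesis
        using pv[OF i] T_eq[of "p i"] T_eq[OF i] \<phi>_eq[OF i] False by auto
    qed
  qed
  then have h: "family_hom n \<phi> v \<in> psh_hom (heap_psh n \<phi>) X"
    by (rule family_hom_in_psh_hom[OF \<phi>])
  have type: "T i = heap_type \<phi> (family_hom n \<phi> v) i" if "i \<in> {1..n}" for i
    using that T_eq[OF that] by (simp add: heap_type_def heap_val_family_hom[OF \<phi>])
  have "\<Gamma> = heap_ctx n \<phi> (family_hom n \<phi> v)"
    by (rule nth_equalityI) (use nth type len in \<open>auto simp: heap_ctx_def simp del: upt_Suc\<close>)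
  moreover have "S = heap_type \<phi> (family_hom n \<phi> v) n"
    using type[of n] assms(4) len by (auto simp: T_def nth_append)
  ultimately show ?thesis using \<phi> h by blast
qed

lemma map_fst_heap_ctx: "map fst (heap_ctx n \<phi> h) = [1..<n]"
  by (simp add: heap_ctx_def comp_def)

lemma degree_heap_ctx: "1 \<le> n \<Longrightarrow> degree (heap_ctx n \<phi> h, R) = n"
  by (simp add: degree_def heap_ctx_def)

lemma canonical_heap_ctx: "1 \<le> n \<Longrightarrow> canonical (heap_ctx n \<phi> h, R)"
  by (simp add: canonical_def map_fst_heap_ctx degree_heap_ctx)

lemma derived_heap_type:
  assumes X: "presheaf X" and "\<phi> \<in> Hp n" "h \<in> psh_hom (heap_psh n \<phi>) X" "1 \<le> n"
  shows "derived (axioms (G X)) (heap_ctx n \<phi> h, IsTy (heap_type \<phi> h n))"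
  using path_ctx_heap_ctx[OF assms(2,3)] path_type_heap[OF assms(2,3)] assms(4)
  by (simp add: derived_iff_path[OF X])

lemma heap_judg_inj:
  assumes "\<phi> \<in> Hp n" "h \<in> psh_hom (heap_psh n \<phi>) X" "\<psi> \<in> Hp n" "g \<in> psh_hom (heap_psh n \<psi>) X"
    and eq: "heap_ctx n \<phi> h = heap_ctx n \<psi> g" "heap_type \<phi> h n = heap_type \<psi> g n"
  shows "\<phi> = \<psi> \<and> h = g"
proof (rule heap_type_inj[OF assms(1-4)])
  fix i
  assume "1 \<le> i" "i \<le> n"
  then show "heap_type \<phi> h i = heap_type \<psi> g i"
    using eq by (cases "i = n") (auto simp: heap_ctx_def)
qed

lemma bij_betw_heap_judg:
  assumes X: "presheaf X" and n: "1 \<le> n"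
  shows "bij_betw (\<lambda>(\<phi>, h). (heap_ctx n \<phi> h, IsTy (heap_type \<phi> h n)))
    (SIGMA \<phi>:Hp n. psh_hom (heap_psh n \<phi>) X)
    {J. derived (axioms (G X)) J \<and> is_ty_judg J \<and> degree J = n \<and> canonical J}"
    (is "bij_betw ?f ?H ?C")
  unfolding bij_betw_def
proof
  show "inj_on ?f ?H"
    by (rule inj_onI) (auto dest: heap_judg_inj)
  have "?f p \<in> ?C" if "p \<in> ?H" for p
    using that derived_heap_type[OF X _ _ n] degree_heap_ctx[OF n] canonical_heap_ctx[OF n]
    by auto
  moreover have "J \<in> ?f ` ?H" if "J \<in> ?C" for J
  proof -
    from that obtain \<Gamma> S where J: "J = (\<Gamma>, IsTy S)"
      by (auto simp: is_ty_judg_iff)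
    moreover have "map fst \<Gamma> = [1..<n]"
      using that J by (auto simp: canonical_def)
    moreover have "path_ctx X \<Gamma>" "path_type X \<Gamma> S"
      using that J by (auto simp: derived_iff_path[OF X])
    ultimately obtain \<phi> h where "\<phi> \<in> Hp n" "h \<in> psh_hom (heap_psh n \<phi>) X"
        "J = ?f (\<phi>, h)"
      using canonical_path_judg_eq_heap[of X \<Gamma> S n] n by auto
    then show ?thesis by blast
  qed
  ultimately show "?f ` ?H = ?C" by blast
qed

section \<open>Elements of the weakening monad\<close>

lemma bij_betw_ty_ident:
  assumes X: "presheaf X" and n: "1 \<le> n"
  shows "bij_betw (ty_ident X n) (SIGMA \<phi>:Hp n. psh_hom (heap_psh n \<phi>) X) (ty_el (W X) n)"
proof -
  have "ty_ident X n = (\<lambda>J. ty_equiv (G X) `` {J}) \<circ>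
      (\<lambda>(\<phi>, h). (heap_ctx n \<phi> h, IsTy (heap_type \<phi> h n)))"
    by auto
  then show ?thesis
    using bij_betw_trans[OF bij_betw_heap_judg[OF X n] bij_betw_canonical_class[OF X]] by simp
qed

lemma bd_ty_ident:
  assumes X: "presheaf X" and n: "1 \<le> n"
    and \<phi>: "\<phi> \<in> Hp (Suc n)" and h: "h \<in> psh_hom (heap_psh (Suc n) \<phi>) X"
  shows "bd (W X) n (ty_ident X (Suc n) (\<phi>, h)) =
    ty_ident X n (heap_bd n \<phi>, hom_restrict h (heap_psh n (heap_bd n \<phi>)))"
proof -
  let ?\<psi> = "heap_bd n \<phi>" and ?g = "hom_restrict h (heap_psh n (heap_bd n \<phi>))"
  let ?J = "(heap_ctx (Suc n) \<phi> h, IsTy (heap_type \<phi> h (Suc n)))"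
  let ?K = "(heap_ctx n ?\<psi> ?g, IsTy (heap_type ?\<psi> ?g n))"
  have type: "heap_type ?\<psi> ?g i = heap_type \<phi> h i" if "1 \<le> i" "i \<le> n" for i
    using dp_path_vars_heap_bd[OF \<phi> that] hom_restrict_heap_bd(2)[OF \<phi> h that]
    by (simp add: heap_type_def)
  have "heap_ctx (Suc n) \<phi> h = heap_ctx n \<phi> h @ [(n, heap_type \<phi> h n)]"
    using n by (simp add: heap_ctx_def)
  moreover have "heap_ctx n ?\<psi> ?g = heap_ctx n \<phi> h"
    using type by (auto simp: heap_ctx_def)
  ultimately have bd: "boundary ?J = [?K]"
    using type n by simp
  have J: "derived (axioms (G X)) ?J"
    using derived_heap_type[OF X \<phi> h] by simp
  then have "(?J, ?J) \<in> ty_equiv (G X)"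
    by (simp add: ty_equiv_iff_alpha_eq[OF X] alpha_eq_refl)
  moreover have "derived (axioms (G X)) ?K"
    using derived_heap_type[OF X heap_bd_Hp[OF \<phi>] hom_restrict_heap_bd(1)[OF \<phi> h] n] .
  ultimately show ?thesis
    using class_boundary[OF X _ _ bd] by (simp add: W_def V_def)
qed

text \<open>
  The class of a term judgement lies over a given class of type judgements exactly if its
  canonical member has the canonical member of the latter as its boundary. The term is then
  determined by its constant, which ranges over the terms of the head of the last type.
\<close>

lemma bij_betw_tm_ident:
  assumes X: "presheaf X" and n: "1 \<le> n"
    and \<phi>: "\<phi> \<in> Hp n" and h: "h \<in> psh_hom (heap_psh n \<phi>) X"
  shows "bij_betw (tm_ident X n (\<phi>, h)) (Tm X (dp \<phi> n) (heap_val \<phi> h n))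
    (Tm (W X) n (ty_ident X n (\<phi>, h)))"
proof -
  let ?T = "heap_type \<phi> h n" and ?\<Gamma> = "heap_ctx n \<phi> h"
  define J where "J a = (?\<Gamma>, HasTy (App (Inr (dp \<phi> n, a)) (path_vars \<phi> n)) ?T)" for a
  let ?A = "Tm X (dp \<phi> n) (heap_val \<phi> h n)"
  have ident: "tm_ident X n (\<phi>, h) a = tm_equiv (G X) `` {J a}" for a
    by (simp add: J_def)
  have K: "derived (axioms (G X)) (?\<Gamma>, IsTy ?T)"
    by (rule derived_heap_type[OF X \<phi> h n])
  have path: "path_ctx X ?\<Gamma>" "path_type X ?\<Gamma> ?T"
    using K by (simp_all add: derived_iff_path[OF X])
  have der: "derived (axioms (G X)) (J a)" if "a \<in> ?A" for a
  proof -
    have "path_term X (App (Inr (dp \<phi> n, a)) (path_vars \<phi> n)) ?T"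
      using that dp_pos[OF \<phi> n] by (auto simp: path_term_def heap_type_def Tm_def)
    then show ?thesis using path by (simp add: J_def derived_iff_path[OF X])
  qed
  have tm: "is_tm_judg (J a)" "degree (J a) = n" "canonical (J a)" for a
    using n by (simp_all add: J_def degree_heap_ctx canonical_heap_ctx)
  have bd: "tm_bd (W X) n (tm_equiv (G X) `` {(\<Gamma>, HasTy t T)}) = ty_equiv (G X) `` {(\<Gamma>, IsTy T)}"
    if t: "derived (axioms (G X)) (\<Gamma>, HasTy t T)" for \<Gamma> t T
  proof -
    have "((\<Gamma>, HasTy t T), (\<Gamma>, HasTy t T)) \<in> tm_equiv (G X)"
      using t by (simp add: tm_equiv_iff_alpha_eq[OF X] alpha_eq_refl)
    moreover have "derived (axioms (G X)) (\<Gamma>, IsTy T)"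
      using t by (simp add: derived_iff_path[OF X])
    ultimately show ?thesis
      using class_boundary[OF X, of "tm_equiv (G X)" "(\<Gamma>, HasTy t T)" "(\<Gamma>, IsTy T)"]
      by (simp add: W_def V_def)
  qed
  have "inj_on (tm_ident X n (\<phi>, h)) ?A"
  proof (rule inj_onI)
    fix a b
    assume ab: "a \<in> ?A" "b \<in> ?A" and "tm_ident X n (\<phi>, h) a = tm_ident X n (\<phi>, h) b"
    then have "alpha_eq (J a) (J b)"
      unfolding ident using tm_class_eq_iff[OF X der[OF ab(1)] der[OF ab(2)]] tm by simp
    then have "J a = J b"
      using canonical_unique[OF X der[OF ab(1)] der[OF ab(2)]] tm by simp
    then show "a = b" by (simp add: J_def)
  qed
  moreover have "tm_ident X n (\<phi>, h) a \<in> Tm (W X) n (ty_ident X n (\<phi>, h))" if a: "a \<in> ?A" for a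
  proof -
    have "tm_equiv (G X) `` {J a} \<in> tm_el (W X) n"
      unfolding W_def V_def using der[OF a] tm by (auto intro: quotientI)
    then show ?thesis
      using bd[OF der[OF a, unfolded J_def]] by (simp add: Tm_def J_def)
  qed
  moreover have "C \<in> tm_ident X n (\<phi>, h) ` ?A" if C: "C \<in> Tm (W X) n (ty_ident X n (\<phi>, h))" for C
  proof -
    from C obtain L0 where L0: "derived (axioms (G X)) L0" "is_tm_judg L0" "degree L0 = n"
      "C = tm_equiv (G X) `` {L0}"
      by (auto simp: Tm_def W_def V_def quotient_def)
    obtain L where L: "derived (axioms (G X)) L" "canonical L" "alpha_eq L L0"
      using ex_canonical[OF X L0(1)] by blast
    note inv = alpha_eq_invariants[OF L(3)]
    have C_eq: "C = tm_equiv (G X) `` {L}"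
      using tm_class_eq_iff[OF X L(1) L0(1)] L L0 inv by simp
    obtain \<Gamma> t T where L_eq: "L = (\<Gamma>, HasTy t T)"
      using inv L0(2) by (auto simp: is_tm_judg_iff)
    have T: "derived (axioms (G X)) (\<Gamma>, IsTy T)"
      using L(1) L_eq by (simp add: derived_iff_path[OF X])
    have "ty_equiv (G X) `` {(\<Gamma>, IsTy T)} = ty_equiv (G X) `` {(?\<Gamma>, IsTy ?T)}"
      using C bd[of \<Gamma> t T] L(1) L_eq C_eq by (simp add: Tm_def)
    then have "alpha_eq (\<Gamma>, IsTy T) (?\<Gamma>, IsTy ?T)"
      using ty_class_eq_iff[OF X T K] by simp
    moreover have "canonical (\<Gamma>, IsTy T)"
      using L(2) L_eq by (simp add: canonical_def degree_def)
    ultimately have eq: "\<Gamma> = ?\<Gamma>" "T = ?T"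
      using canonical_unique[OF X T K _ canonical_heap_ctx[OF n]] by auto
    have "path_term X t ?T"
      using L(1) L_eq eq by (simp add: derived_iff_path[OF X])
    then obtain a where "a \<in> ?A" "L = J a"
      using L_eq eq by (auto simp: path_term_def heap_type_def Tm_def J_def)
    then show ?thesis using C_eq ident by blast
  qed
  ultimately show ?thesis unfolding bij_betw_def by blast
qed

theorem proposition17:
  fixes X :: "('a, 'b) tts"
  assumes "presheaf X"
  shows
    "(\<forall>n\<ge>1. bij_betw (ty_ident X n) (SIGMA \<phi>:Hp n. psh_hom (heap_psh n \<phi>) X) (ty_el (W X) n)) \<and>
     (\<forall>n\<ge>1. \<forall>\<phi>\<in>Hp (Suc n). \<forall>h\<in>psh_hom (heap_psh (Suc n) \<phi>) X.
        heap_bd n \<phi> \<in> Hp n \<and>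
        hom_restrict h (heap_psh n (heap_bd n \<phi>)) \<in> psh_hom (heap_psh n (heap_bd n \<phi>)) X \<and>
        bd (W X) n (ty_ident X (Suc n) (\<phi>, h)) =
          ty_ident X n (heap_bd n \<phi>, hom_restrict h (heap_psh n (heap_bd n \<phi>)))) \<and>
     (\<forall>n\<ge>1. \<forall>\<phi>\<in>Hp n. \<forall>h\<in>psh_hom (heap_psh n \<phi>) X.
        bij_betw (tm_ident X n (\<phi>, h))
          (Tm X (dp \<phi> n) (heap_val \<phi> h n))
          (Tm (W X) n (ty_ident X n (\<phi>, h))))"
  using bij_betw_ty_ident[OF assms] heap_bd_Hp hom_restrict_heap_bd(1) bd_ty_ident[OF assms]
    bij_betw_tm_ident[OF assms]
  by (intro conjI allI impI ballI)

end
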